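(* Let $\rho\in\mathcal C$. For every $n\ge1$ let $\pi_n$ be a random permutation in $S_n$ with law $\mathbb P_n$ such that for every positive integer $l$, \[ \lim_{n\to\infty}\sup_{\mathbf p,\mathbf q\in\mathcal S(n,l)}\left|\frac{n^l\,\mathbb P_n(\pi_n(\mathbf p)=\mathbf q)}{\prod_{a=1}^l\rho\left(\frac{p_a}{n},\frac{q_a}{n}\right)}-1\right|=0. \] For $a\ge1$ let $C_n(a)$ be the number of cycles of length $a$ of $\pi_n$, and let \[ c_\rho(a)=\frac1a\int_{[0,1]^a}\rho(x_1,x_2)\rho(x_2,x_3)\cdots\rho(x_{a-1},x_a)\rho(x_a,x_1)\,dx_1\cdots dx_a. \] Then for every $l\in\mathbb N$ and every $(k_1,\dots,k_l)\in\mathbb N^l$, \[ \lim_{n\to\infty}\mathbb E\prod_{a=1}^l C_n(a)^{k_a}=\prod_{a=1}^l\mathbb E\,\mathrm{Poi}(c_\rho(a))^{k_a}. \] In particular $(C_n(1),\dots,C_n(l))$ converges in distribution to $(\mathrm{Poi}(c_\rho(1)),\dots,\mathrm{Poi}(c_\rho(l)))$ with mutually independent coordinates.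
   Context: $[n]=\{1,\dots,n\}$. $\mathcal S(n,l)=\{\mathbf p=(p_1,\dots,p_l)\in[n]^l: p_a\ne p_b \text{ for } a\ne b\}$; for a permutation $\pi_n$, $\pi_n(\mathbf p)=(\pi_n(p_1),\dots,\pi_n(p_l))$. $\mathcal C$ is the set of strictly positive continuous functions $\rho$ on $[0,1]^2$ with $\int_0^1\rho(x,y)\,dx=\int_0^1\rho(x,y)\,dy=1$ for all $x,y$. $\mathrm{Poi}(\lambda)$ denotes a Poisson random variable with mean $\lambda$. *)

theory Defs
  imports "HOL-Probability.Probability" "HOL-Combinatorics.Combinatorics"
begin

definition in_C :: "(real \<Rightarrow> real \<Rightarrow> real) \<Rightarrow> bool" where
  "in_C \<rho> \<longleftrightarrow>
     continuous_on ({0..1} \<times> {0..1}) (\<lambda>(x, y). \<rho> x y) \<and>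
     (\<forall>x\<in>{0..1}. \<forall>y\<in>{0..1}. \<rho> x y > 0) \<and>
     (\<forall>y\<in>{0..1}. integral {0..1} (\<lambda>x. \<rho> x y) = 1) \<and>
     (\<forall>x\<in>{0..1}. integral {0..1} (\<lambda>y. \<rho> x y) = 1)"

definition S_tuples :: "nat \<Rightarrow> nat \<Rightarrow> nat list set" where
  "S_tuples n l = {p. length p = l \<and> distinct p \<and> set p \<subseteq> {1..n}}"

definition cycle_count :: "(nat \<Rightarrow> nat) \<Rightarrow> nat \<Rightarrow> nat \<Rightarrow> nat" where
  "cycle_count \<sigma> n a = card {orbit \<sigma> x | x. x \<in> {1..n} \<and> card (orbit \<sigma> x) = a}"

definition c_rho :: "(real \<Rightarrow> real \<Rightarrow> real) \<Rightarrow> nat \<Rightarrow> real" where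
  "c_rho \<rho> a = (1 / real a) *
     (\<integral>x. (\<Prod>i<a. \<rho> (x i) (x (Suc i mod a)))
        \<partial>(PiM {..<a} (\<lambda>_. restrict_space lborel {0..1::real})))"

end

theory Submission
  imports Defs
begin

text \<open>For a permutation of \<open>{1..n}\<close>, the product over \<open>a\<close> of \<open>a ^ r a\<close> times the falling factorial of
  order \<open>r a\<close> of the number of \<open>a\<close>-cycles counts the tuples of distinct points on which the
  permutation acts as a fixed block-cyclic shift. By the hypothesis on the law, the expectation of
  this count is asymptotically a Riemann sum for a product of cyclic integrals of \<open>\<rho>\<close>; repeated
  points contribute a vanishing fraction. Hence the joint factorial moments converge to products of
  powers of \<open>c_rho \<rho> a\<close>, the factorial moments of independent Poisson variables. Ordinary moments
  follow by linearity, and point probabilities by the Bonferroni inequalities, treating one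
  coordinate at a time with the others as a nonnegative weight.\<close>

section \<open>Falling factorials of cycle counts\<close>

text \<open>The hypothesis bounds a relative error uniformly over tuples. Summing over about
  \<open>n ^ l\<close> tuples therefore costs only \<open>\<epsilon>\<close> times a convergent sum,
  and no rate of convergence is required. Sums over distinct tuples do not factor over blocks, while
  sums over the full grid do; this is why the repeated points are added first and removed
  afterwards. A Bonferroni sum of fixed length involves finitely many factorial moments, so
  \<open>n\<close> tends to infinity at fixed truncation and the truncation is lifted afterwards.
  This takes the place of the fact that a Poisson law is determined by its moments. The inequalities
  survive multiplication by a nonnegative weight, which lets a one-dimensional sandwich yield the
  joint law. Strict positivity of \<open>\<rho>\<close> on a compact square gives a lower bound
  \<open>\<delta> > 0\<close>. It makes the quotients in the hypothesis meaningful and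
  \<open>c_rho \<rho> a\<close> positive, as a Poisson parameter must be here.\<close>

definition falling :: "nat \<Rightarrow> nat \<Rightarrow> real" where
  "falling x r = (\<Prod>i<r. real x - real i)"

lemma falling_0 [simp]: "falling x 0 = 1"
  by (simp add: falling_def)

lemma falling_Suc: "falling x (Suc r) = falling x r * (real x - real r)"
  by (simp add: falling_def)

lemma falling_eq_0: "x < r \<Longrightarrow> falling x r = 0"
  by (auto simp: falling_def)

lemma falling_nonneg: "falling x r \<ge> 0"
proof (cases "x < r")
  case False
  then show ?thesis unfolding falling_def by (intro prod_nonneg) auto
qed (simp add: falling_eq_0)

text \<open>Splitting off the first \<open>m\<close> factors leaves the numerator of a generalized
  binomial coefficient with upper index \<open>x - m\<close>; \<open>bonferroni_identity\<close>
  relies on this.\<close>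

lemma falling_add: "falling x (m + j) = falling x m * (\<Prod>i<j. real x - real m - real i)"
  by (induction j) (simp_all add: falling_Suc algebra_simps)

lemma falling_ge: "falling (r + i) r = fact (r + i) / fact i"
proof (induction r)
  case (Suc r)
  have "falling (Suc r + i) (Suc r) = real (Suc r + i) * falling (r + i) r"
    unfolding falling_def by (subst prod.lessThan_Suc_shift) simp
  then show ?case using Suc by simp
qed simp

text \<open>Each cycle of length \<open>a\<close> contributes \<open>a\<close> lists, one for each starting point.\<close>

definition cycle_lists :: "(nat \<Rightarrow> nat) \<Rightarrow> nat set \<Rightarrow> nat \<Rightarrow> nat list set" where
  "cycle_lists \<sigma> S a = {x. length x = a \<and> distinct x \<and> set x \<subseteq> S \<and> map \<sigma> x = rotate1 x}"

text \<open>The list equation sends each entry to its cyclic successor; iterating it shows that a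
  cycle list is determined by its head.\<close>

lemma cycle_list_nth:
  assumes "map \<sigma> x = rotate1 x" "x \<noteq> []"
  shows "(\<sigma> ^^ i) (hd x) = x ! (i mod length x)"
proof (induction i)
  case 0
  then show ?case using assms by (simp add: hd_conv_nth)
next
  case (Suc i)
  have l: "i mod length x < length x" using assms by simp
  have "\<sigma> (x ! (i mod length x)) = rotate1 x ! (i mod length x)"
    using l assms(1) by (metis nth_map)
  also have "\<dots> = x ! (Suc i mod length x)"
    using l by (simp add: nth_rotate1 mod_Suc_eq)
  finally show ?case using Suc by simp
qed

lemma cycle_list_orbit:
  assumes "map \<sigma> x = rotate1 x" "x \<noteq> []" "y \<in> set x"
  shows "orbit \<sigma> y = set x"
proof -
  note n = cycle_list_nth[OF assms(1,2)]
  have 1: "(\<sigma> ^^ length x) (hd x) = hd x"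
    using n[of "length x"] n[of 0] by simp
  have "orbit \<sigma> (hd x) = {(\<sigma> ^^ m) (hd x) | m. m < length x}"
    by (rule orbit_altdef_bounded[OF 1]) (use assms in auto)
  also have "\<dots> = set x"
    unfolding n set_conv_nth by (metis mod_less)
  finally have o: "orbit \<sigma> (hd x) = set x" .
  have "cyclic_on \<sigma> (set x)"
    using o assms(2) by (intro cyclic_on_singleI[of "hd x"]) auto
  then show ?thesis using assms(3) by (rule orbit_cyclic_eq3)
qed

text \<open>\<open>funpow_dist1 \<sigma> y y\<close> is the first return time to \<open>y\<close>.
  It equals the orbit size, and the iterates before it are distinct, so listing them from
  \<open>y\<close> gives the cycle list with head \<open>y\<close>.\<close>

lemma orbit_cycle_list:
  assumes "\<sigma> permutes S" "finite S" "y \<in> S" "a = card (orbit \<sigma> y)"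
  shows "map (\<lambda>i. (\<sigma> ^^ i) y) [0..<a] \<in> cycle_lists \<sigma> S a" "a > 0"
proof -
  have self: "y \<in> orbit \<sigma> y"
    using assms by (intro permutation_self_in_orbit) (auto simp: permutation_permutes)
  let ?d = "funpow_dist1 \<sigma> y y"
  note inj = inj_on_funpow_dist1[OF self] and orb = orbit_conv_funpow_dist1[OF self]
  have a: "a = ?d"
    unfolding assms(4) by (subst orb, subst card_image[OF inj]) simp
  then show "a > 0" by simp
  have per: "(\<sigma> ^^ a) y = y" unfolding a by (rule funpow_dist1_prop[OF self])
  let ?x = "map (\<lambda>i. (\<sigma> ^^ i) y) [0..<a]"
  have "distinct ?x" using inj unfolding a distinct_map by (metis distinct_upt set_upt)
  moreover have "set ?x = orbit \<sigma> y" unfolding set_map set_upt a using orb by (rule sym)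
  then have "set ?x \<subseteq> S" using permutes_orbit_subset[OF assms(1,3)] by simp
  moreover have "map \<sigma> ?x = rotate1 ?x"
  proof (rule nth_equalityI)
    fix i assume i: "i < length (map \<sigma> ?x)"
    \<comment> \<open>The return to \<open>y\<close> matters only at the last index, where the
      rotated list wraps around.\<close>
    then have "Suc i < a \<or> Suc i = a" by auto
    then show "map \<sigma> ?x ! i = rotate1 ?x ! i"
      using i per \<open>a > 0\<close> by (auto simp: nth_rotate1)
  qed simp
  ultimately show "?x \<in> cycle_lists \<sigma> S a" by (simp add: cycle_lists_def)
qed

text \<open>\<open>U\<close> stands for the points occupied by other blocks. Since \<open>U\<close>
  is closed under orbits, a cycle either lies inside \<open>U\<close> or misses it, so avoiding
  \<open>U\<close> is a condition on the head alone.\<close>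

lemma bij_betw_hd_cycle_lists:
  assumes "\<sigma> permutes S" "finite S" "a > 0"
    and closed: "\<And>y. y \<in> U \<Longrightarrow> orbit \<sigma> y \<subseteq> U"
  shows "bij_betw hd {x \<in> cycle_lists \<sigma> S a. set x \<inter> U = {}} {y \<in> S - U. card (orbit \<sigma> y) = a}"
proof (rule bij_betw_byWitness[where f' = "\<lambda>y. map (\<lambda>i. (\<sigma> ^^ i) y) [0..<a]"])
  let ?f' = "\<lambda>y. map (\<lambda>i. (\<sigma> ^^ i) y) [0..<a]"
  have C: "x \<noteq> []" "orbit \<sigma> (hd x) = set x" "map \<sigma> x = rotate1 x" "length x = a" "distinct x" "set x \<subseteq> S"
    if "x \<in> cycle_lists \<sigma> S a" for x
    using that \<open>a > 0\<close> cycle_list_orbit[of \<sigma> x "hd x"] by (auto simp: cycle_lists_def)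
  show "\<forall>x\<in>{x \<in> cycle_lists \<sigma> S a. set x \<inter> U = {}}. ?f' (hd x) = x"
    using C(1,3,4) by (auto intro!: nth_equalityI simp: cycle_list_nth)
  show "\<forall>y\<in>{y \<in> S - U. card (orbit \<sigma> y) = a}. hd (?f' y) = y"
    using \<open>a > 0\<close> by (simp add: hd_map)
  show "hd ` {x \<in> cycle_lists \<sigma> S a. set x \<inter> U = {}} \<subseteq> {y \<in> S - U. card (orbit \<sigma> y) = a}"
  proof (rule image_subsetI)
    fix x assume x: "x \<in> {x \<in> cycle_lists \<sigma> S a. set x \<inter> U = {}}"
    then have "x \<in> cycle_lists \<sigma> S a" by simp
    note C = C[OF this]
    have "hd x \<in> S - U" using hd_in_set[OF C(1)] C(6) x by blast
    moreover have "card (orbit \<sigma> (hd x)) = a" using C distinct_card by metis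
    ultimately show "hd x \<in> {y \<in> S - U. card (orbit \<sigma> y) = a}" by simp
  qed
  show "?f' ` {y \<in> S - U. card (orbit \<sigma> y) = a} \<subseteq> {x \<in> cycle_lists \<sigma> S a. set x \<inter> U = {}}"
  proof (rule image_subsetI)
    fix y assume "y \<in> {y \<in> S - U. card (orbit \<sigma> y) = a}"
    then have y: "y \<in> S" "y \<notin> U" "a = card (orbit \<sigma> y)" by auto
    have m: "?f' y \<in> cycle_lists \<sigma> S a" by (rule orbit_cycle_list(1)[OF assms(1,2) y(1,3)])
    have ym: "y \<in> set (?f' y)" using \<open>a > 0\<close> by (force simp: image_iff)
    have "z \<notin> U" if z: "z \<in> set (?f' y)" for z
    proof
      assume zU: "z \<in> U"
      have "map \<sigma> (?f' y) = rotate1 (?f' y)" using m unfolding cycle_lists_def by blast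
      moreover have "?f' y \<noteq> []" using \<open>a > 0\<close> by simp
      ultimately have "orbit \<sigma> z = set (?f' y)" using z by (rule cycle_list_orbit)
      then show False using closed[OF zU] ym y(2) by auto
    qed
    then show "?f' y \<in> {x \<in> cycle_lists \<sigma> S a. set x \<inter> U = {}}" using m by blast
  qed
qed

text \<open>\<open>cycle_count\<close> counts orbits as sets. The orbits of size \<open>a\<close>
  are pairwise disjoint, and their union is the set of points on the left.\<close>

lemma card_cycle_points:
  assumes "\<sigma> permutes {1..n}"
  shows "card {y \<in> {1..n}. card (orbit \<sigma> y) = a} = a * cycle_count \<sigma> n a"
proof -
  let ?O = "{orbit \<sigma> x | x. x \<in> {1..n} \<and> card (orbit \<sigma> x) = a}"
  have self: "y \<in> orbit \<sigma> y" for y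
    using assms by (intro permutation_self_in_orbit) (auto simp: permutation_permutes)
  have sub: "orbit \<sigma> y \<subseteq> {1..n}" if "y \<in> {1..n}" for y
    using permutes_orbit_subset[OF assms that] .
  have eq: "orbit \<sigma> z = orbit \<sigma> y" if "z \<in> orbit \<sigma> y" for z y
    using cyclic_on_orbit[OF assms, of y] that orbit_cyclic_eq3 by fastforce
  have U: "\<Union>?O = {y \<in> {1..n}. card (orbit \<sigma> y) = a}"
  proof safe
    fix y z assume "y \<in> orbit \<sigma> z" "z \<in> {1..n}" "a = card (orbit \<sigma> z)"
    then show "y \<in> {1..n}" "card (orbit \<sigma> y) = card (orbit \<sigma> z)" using sub[of z] eq[of y z] by auto
  next
    fix y assume "y \<in> {1..n}" "a = card (orbit \<sigma> y)"
    then show "y \<in> \<Union> {orbit \<sigma> x |x. x \<in> {1..n} \<and> card (orbit \<sigma> x) = card (orbit \<sigma> y)}" using self[of y] by blast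
  qed
  have "a * card ?O = card (\<Union>?O)"
  proof (rule card_partition)
    show "finite ?O" by simp
    show "finite (\<Union>?O)" unfolding U by simp
    show "card c = a" if "c \<in> ?O" for c using that by auto
    show "c1 \<inter> c2 = {}" if "c1 \<in> ?O" "c2 \<in> ?O" "c1 \<noteq> c2" for c1 c2
      using that eq by blast
  qed
  then show ?thesis unfolding U cycle_count_def by simp
qed

section \<open>Tuples composed of several cycles\<close>

text \<open>\<open>map \<sigma> p = rotate_blocks as p\<close> says that every block of
  \<open>p\<close> is a cycle of \<open>\<sigma>\<close>. As an event it has the form "the
  permutation maps \<open>p\<close> to \<open>q\<close>", whose probability the hypothesis on the
  law estimates.\<close>

primrec rotate_blocks :: "nat list \<Rightarrow> 'a list \<Rightarrow> 'a list" where
  "rotate_blocks [] p = []"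
| "rotate_blocks (a # as) p = rotate1 (take a p) @ rotate_blocks as (drop a p)"

lemma mset_rotate1: "mset (rotate1 xs) = mset xs"
  by (cases xs) auto

text \<open>Equality of multisets transfers length, entries and distinctness at once.\<close>

lemma mset_rotate_blocks:
  "length p = sum_list as \<Longrightarrow> mset (rotate_blocks as p) = mset p"
proof (induction as arbitrary: p)
  case (Cons a as)
  have "mset (rotate_blocks (a # as) p) = mset (take a p) + mset (drop a p)"
    using Cons mset_rotate1 by simp
  then show ?case by (metis append_take_drop_id mset_append)
qed simp

lemma rotate_blocks_S_tuples:
  assumes "p \<in> S_tuples n (sum_list as)"
  shows "rotate_blocks as p \<in> S_tuples n (sum_list as)"
proof -
  have "mset (rotate_blocks as p) = mset p"
    using assms by (intro mset_rotate_blocks) (auto simp: S_tuples_def)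
  from mset_eq_imp_distinct_iff[OF this] mset_eq_setD[OF this] mset_eq_length[OF this] show ?thesis
    using assms by (simp add: S_tuples_def)
qed

text \<open>A member of this set is a sequence of cycles with chosen starting points and of prescribed
  lengths; the cycles are pairwise different because the entries of the concatenation are.
  This is why falling factorials of the cycle counts appear.\<close>

definition block_cycles :: "(nat \<Rightarrow> nat) \<Rightarrow> nat \<Rightarrow> nat list \<Rightarrow> nat list set" where
  "block_cycles \<sigma> n as = {p \<in> S_tuples n (sum_list as). map \<sigma> p = rotate_blocks as p}"

lemma finite_S_tuples [simp]: "finite (S_tuples n l)"
  by (rule finite_subset[OF _ finite_lists_length_eq[of "{1..n}" l]]) (auto simp: S_tuples_def)

lemma finite_block_cycles [simp]: "finite (block_cycles \<sigma> n as)"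
  by (simp add: block_cycles_def)

text \<open>Peeling off the first block gives a dependent sum, because the admissible first blocks
  depend on the points occupied by the others.\<close>

lemma block_cycles_Cons:
  "block_cycles \<sigma> n (a # as) = (\<lambda>(p, x). x @ p) `
     (SIGMA p:block_cycles \<sigma> n as. {x \<in> cycle_lists \<sigma> {1..n} a. set x \<inter> set p = {}})" (is "?L = ?R")
proof
  show "?L \<subseteq> ?R"
  proof
    fix q assume "q \<in> ?L"
    then have q: "length q = a + sum_list as" "distinct q" "set q \<subseteq> {1..n}"
      "map \<sigma> q = rotate1 (take a q) @ rotate_blocks as (drop a q)"
      by (auto simp: block_cycles_def S_tuples_def)
    define x p where "x = take a q" and "p = drop a q"
    have qx: "q = x @ p" by (simp add: x_def p_def)
    have l: "length x = a" "length p = sum_list as" using q(1) by (auto simp: x_def p_def)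
    have m: "map \<sigma> x = rotate1 x \<and> map \<sigma> p = rotate_blocks as p"
      using q(4) l unfolding x_def[symmetric] p_def[symmetric] qx map_append
      by (subst (asm) append_eq_append_conv) auto
    have "(p, x) \<in> (SIGMA p:block_cycles \<sigma> n as. {x \<in> cycle_lists \<sigma> {1..n} a. set x \<inter> set p = {}})"
      using q(2,3) l m unfolding qx by (auto simp: block_cycles_def S_tuples_def cycle_lists_def)
    then show "q \<in> ?R" unfolding qx by force
  qed
  show "?R \<subseteq> ?L"
    by (auto simp: block_cycles_def S_tuples_def cycle_lists_def simp del: atLeastAtMost_iff)
qed

text \<open>The occupied points form a union of cycles whose lengths are listed in
  \<open>as\<close>, so the room left for a further block is the same for every \<open>p\<close>.
  Excluding \<open>0\<close> makes every block nonempty and hence a full orbit.\<close>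

lemma block_cycles_points:
  assumes "p \<in> block_cycles \<sigma> n as" "0 \<notin> set as"
  shows "card {y \<in> set p. card (orbit \<sigma> y) = b} = b * count_list as b \<and>
    (\<forall>y\<in>set p. orbit \<sigma> y \<subseteq> set p)"
  using assms
proof (induction as arbitrary: p)
  case Nil
  then show ?case by (simp add: block_cycles_def S_tuples_def)
next
  case (Cons a as)
  then obtain x q where p: "p = x @ q" "q \<in> block_cycles \<sigma> n as" "x \<in> cycle_lists \<sigma> {1..n} a"
    "set x \<inter> set q = {}" by (auto simp: block_cycles_Cons)
  have x: "length x = a" "distinct x" "map \<sigma> x = rotate1 x" "x \<noteq> []"
    using p(3) Cons.prems(2) by (auto simp: cycle_lists_def)
  have o: "orbit \<sigma> y = set x" if "y \<in> set x" for y
    using cycle_list_orbit[OF x(3,4) that] .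
  have IH: "card {y \<in> set q. card (orbit \<sigma> y) = b} = b * count_list as b"
    "\<forall>y\<in>set q. orbit \<sigma> y \<subseteq> set q"
    using Cons p(2) by auto
  have "{y \<in> set p. card (orbit \<sigma> y) = b} =
      {y \<in> set x. card (orbit \<sigma> y) = b} \<union> {y \<in> set q. card (orbit \<sigma> y) = b}"
    unfolding p by auto
  also have "card \<dots> = card {y \<in> set x. card (orbit \<sigma> y) = b} + card {y \<in> set q. card (orbit \<sigma> y) = b}"
    using p(4) by (intro card_Un_disjoint) auto
  also have "{y \<in> set x. card (orbit \<sigma> y) = b} = (if a = b then set x else {})"
    using o x(1) distinct_card[OF x(2)] by auto
  finally show ?case using IH o x distinct_card[OF x(2)] by (auto simp: p(1))
qed

lemma card_block_cycles_Cons: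
  assumes "\<sigma> permutes {1..n}" "0 \<notin> set (a # as)"
  shows "real (card (block_cycles \<sigma> n (a # as))) =
    real a * (real (cycle_count \<sigma> n a) - real (count_list as a)) * real (card (block_cycles \<sigma> n as))"
proof -
  let ?F = "\<lambda>p. {x \<in> cycle_lists \<sigma> {1..n} a. set x \<inter> set p = {}}"
  have inj: "inj_on (\<lambda>(p, x). x @ p) (SIGMA p:block_cycles \<sigma> n as. ?F p)"
    by (auto simp: inj_on_def cycle_lists_def)
  have fin: "finite (?F p)" for p
    by (rule finite_subset[OF _ finite_lists_length_eq[of "{1..n}" a]]) (auto simp: cycle_lists_def)
  have F: "real (card (?F p)) = real a * (real (cycle_count \<sigma> n a) - real (count_list as a))"
    if p: "p \<in> block_cycles \<sigma> n as" for p
  proof -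
    have bp: "card {y \<in> set p. card (orbit \<sigma> y) = a} = a * count_list as a"
      "\<And>y. y \<in> set p \<Longrightarrow> orbit \<sigma> y \<subseteq> set p"
      using block_cycles_points[OF p, of a] assms(2) by auto
    have "card (?F p) = card {y \<in> {1..n} - set p. card (orbit \<sigma> y) = a}"
      by (rule bij_betw_same_card[OF bij_betw_hd_cycle_lists]) (use assms bp in auto)
    moreover have "card {y \<in> {1..n}. card (orbit \<sigma> y) = a} =
        card {y \<in> {1..n} - set p. card (orbit \<sigma> y) = a} + card {y \<in> set p. card (orbit \<sigma> y) = a}"
    proof (subst card_Un_disjoint[symmetric])
      have "set p \<subseteq> {1..n}" using p by (auto simp: block_cycles_def S_tuples_def)
      then show "card {y \<in> {1..n}. card (orbit \<sigma> y) = a} =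
        card ({y \<in> {1..n} - set p. card (orbit \<sigma> y) = a} \<union> {y \<in> set p. card (orbit \<sigma> y) = a})"
        by (intro arg_cong[where f = card]) auto
    qed auto
    ultimately have "a * cycle_count \<sigma> n a = card (?F p) + a * count_list as a"
      using bp(1) card_cycle_points[OF assms(1), of a] by simp
    then have "real a * real (cycle_count \<sigma> n a) = real (card (?F p)) + real a * real (count_list as a)"
      by (simp flip: of_nat_add of_nat_mult)
    then show ?thesis by (simp add: algebra_simps)
  qed
  have "real (card (block_cycles \<sigma> n (a # as))) = real (\<Sum>p\<in>block_cycles \<sigma> n as. card (?F p))"
    unfolding block_cycles_Cons card_image[OF inj] using fin by (subst card_SigmaI) auto
  also have "\<dots> = (\<Sum>p\<in>block_cycles \<sigma> n as. real a * (real (cycle_count \<sigma> n a) - real (count_list as a)))"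
    unfolding of_nat_sum by (rule sum.cong) (use F in auto)
  finally show ?thesis by (simp add: mult_ac)
qed

text \<open>Each peeled block contributes \<open>a\<close> and the next factor of the falling
  factorial, as in \<open>falling_Suc\<close>. Lengths in \<open>A\<close> that do not occur in
  \<open>as\<close> contribute 1, so \<open>A\<close> can be fixed in advance.\<close>

lemma card_block_cycles:
  assumes "\<sigma> permutes {1..n}" "0 \<notin> A" "finite A" "set as \<subseteq> A"
  shows "real (card (block_cycles \<sigma> n as)) =
    (\<Prod>a\<in>A. real a ^ count_list as a * falling (cycle_count \<sigma> n a) (count_list as a))"
  using assms(4)
proof (induction as)
  case Nil
  have "block_cycles \<sigma> n [] = {[]}" by (auto simp: block_cycles_def S_tuples_def)
  then show ?case by simp
next
  case (Cons a as)
  let ?g = "\<lambda>as b. real b ^ count_list as b * falling (cycle_count \<sigma> n b) (count_list as b)"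
  have a: "a \<in> A" and as: "set as \<subseteq> A" using Cons.prems by auto
  have "(\<Prod>b\<in>A. ?g (a # as) b) = ?g (a # as) a * (\<Prod>b\<in>A-{a}. ?g (a # as) b)"
    by (rule prod.remove[OF assms(3) a])
  also have "(\<Prod>b\<in>A-{a}. ?g (a # as) b) = (\<Prod>b\<in>A-{a}. ?g as b)"
    by (rule prod.cong) auto
  also have "?g (a # as) a = real a * (real (cycle_count \<sigma> n a) - real (count_list as a)) * ?g as a"
    by (simp add: falling_Suc)
  also have "\<dots> * (\<Prod>b\<in>A-{a}. ?g as b) =
      real a * (real (cycle_count \<sigma> n a) - real (count_list as a)) * (\<Prod>b\<in>A. ?g as b)"
    using prod.remove[OF assms(3) a, of "?g as"] by simp
  also have "\<dots> = real (card (block_cycles \<sigma> n (a # as)))"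
  proof -
    have "0 \<notin> set (a # as)" using Cons.prems assms(2) by blast
    from card_block_cycles_Cons[OF assms(1) this] show ?thesis using Cons.IH[OF as] by simp
  qed
  finally show ?case by simp
qed

section \<open>Poisson limits from factorial moments\<close>

text \<open>The terms with \<open>j < r\<close> vanish; after a shift by \<open>r\<close> the rest
  is \<open>\<mu> ^ r\<close> times the Poisson weights. The nonnegative integral yields
  integrability together with the value.\<close>

lemma falling_poisson:
  assumes "\<mu> > 0"
  shows "has_bochner_integral (measure_pmf (poisson_pmf \<mu>)) (\<lambda>j. falling j r) (\<mu> ^ r)"
proof (rule has_bochner_integral_nn_integral)
  let ?f = "\<lambda>j. pmf (poisson_pmf \<mu>) j * falling j r"
  have "(\<lambda>i. \<mu> ^ r * exp (-\<mu>) * (\<mu> ^ i / fact i)) sums (\<mu> ^ r * exp (-\<mu>) * exp \<mu>)"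
    using exp_converges[of \<mu>] by (intro sums_mult) (simp add: scaleR_conv_of_real divide_inverse mult.commute)
  moreover have "\<mu> ^ r * exp (-\<mu>) * (\<mu> ^ i / fact i) = ?f (i + r)" for i
    using assms falling_ge[of r i] by (simp add: power_add add.commute field_simps)
  moreover have "\<mu> ^ r * exp (-\<mu>) * exp \<mu> = \<mu> ^ r" by (simp add: exp_minus)
  ultimately have "(\<lambda>i. ?f (i + r)) sums \<mu> ^ r" by simp
  moreover have "(\<Sum>i<r. ?f i) = 0" by (simp add: falling_eq_0)
  ultimately have s: "?f sums \<mu> ^ r"
    using sums_iff_shift[of ?f r "\<mu> ^ r"] by simp
  have "(\<integral>\<^sup>+ j. ennreal (falling j r) \<partial>measure_pmf (poisson_pmf \<mu>)) = (\<Sum>j. ennreal (?f j))"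
    by (simp add: nn_integral_measure_pmf nn_integral_count_space_nat ennreal_mult' falling_nonneg)
  also have "\<dots> = ennreal (\<mu> ^ r)"
    by (rule suminf_ennreal_eq[OF _ s]) (simp add: falling_nonneg del: pmf_poisson)
  finally show "(\<integral>\<^sup>+ j. ennreal (falling j r) \<partial>measure_pmf (poisson_pmf \<mu>)) = ennreal (\<mu> ^ r)" .
qed (use assms in \<open>auto simp: falling_nonneg\<close>)

text \<open>The recursion \<open>j * falling j r = falling j (Suc r) + r * falling j r\<close>
  trades powers for falling factorials, on both sides of the limit alike. Finite support makes every
  expectation linear.\<close>

lemma weighted_power_limit:
  fixes P :: "nat \<Rightarrow> 'b pmf" and X :: "nat \<Rightarrow> 'b \<Rightarrow> nat" and W :: "nat \<Rightarrow> 'b \<Rightarrow> real"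
  assumes "\<mu> > 0" and fin: "\<forall>\<^sub>F n in sequentially. finite (set_pmf (P n))"
    and lim: "\<And>r. (\<lambda>n. measure_pmf.expectation (P n) (\<lambda>\<sigma>. W n \<sigma> * falling (X n \<sigma>) r)) \<longlonglongrightarrow> w * \<mu> ^ r"
  shows "(\<lambda>n. measure_pmf.expectation (P n) (\<lambda>\<sigma>. W n \<sigma> * real (X n \<sigma>) ^ k)) \<longlonglongrightarrow>
    w * measure_pmf.expectation (poisson_pmf \<mu>) (\<lambda>j. real j ^ k)"
proof -
  \<comment> \<open>Only a common constant \<open>c\<close> is carried through the induction, so no
    Stirling numbers appear. General \<open>r\<close> is essential, since the step for
    \<open>k\<close> uses orders \<open>r\<close> and \<open>Suc r\<close>.\<close>
  have "\<exists>c. has_bochner_integral (measure_pmf (poisson_pmf \<mu>)) (\<lambda>j. real j ^ k * falling j r) c \<and>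
    (\<lambda>n. measure_pmf.expectation (P n) (\<lambda>\<sigma>. W n \<sigma> * (real (X n \<sigma>) ^ k * falling (X n \<sigma>) r))) \<longlonglongrightarrow> w * c"
    for k r
  proof (induction k arbitrary: r)
    case 0
    show ?case using falling_poisson[OF \<open>\<mu> > 0\<close>, of r] lim[of r] by auto
  next
    case (Suc k)
    have eq: "real j ^ Suc k * falling j r = real j ^ k * falling j (Suc r) + real r * (real j ^ k * falling j r)" for j
      by (simp add: falling_Suc algebra_simps)
    obtain c where c: "has_bochner_integral (measure_pmf (poisson_pmf \<mu>)) (\<lambda>j. real j ^ k * falling j r) c"
      "(\<lambda>n. measure_pmf.expectation (P n) (\<lambda>\<sigma>. W n \<sigma> * (real (X n \<sigma>) ^ k * falling (X n \<sigma>) r))) \<longlonglongrightarrow> w * c"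
      using Suc[of r] by blast
    obtain d where d: "has_bochner_integral (measure_pmf (poisson_pmf \<mu>)) (\<lambda>j. real j ^ k * falling j (Suc r)) d"
      "(\<lambda>n. measure_pmf.expectation (P n) (\<lambda>\<sigma>. W n \<sigma> * (real (X n \<sigma>) ^ k * falling (X n \<sigma>) (Suc r)))) \<longlonglongrightarrow> w * d"
      using Suc[of "Suc r"] by blast
    have "has_bochner_integral (measure_pmf (poisson_pmf \<mu>)) (\<lambda>j. real j ^ Suc k * falling j r) (d + real r * c)"
      unfolding eq by (intro has_bochner_integral_add has_bochner_integral_mult_right c d)
    moreover have "(\<lambda>n. measure_pmf.expectation (P n) (\<lambda>\<sigma>. W n \<sigma> * (real (X n \<sigma>) ^ Suc k * falling (X n \<sigma>) r)))
        \<longlonglongrightarrow> w * (d + real r * c)"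
    proof (rule Lim_transform_eventually)
      show "(\<lambda>n. measure_pmf.expectation (P n) (\<lambda>\<sigma>. W n \<sigma> * (real (X n \<sigma>) ^ k * falling (X n \<sigma>) (Suc r))) +
          real r * measure_pmf.expectation (P n) (\<lambda>\<sigma>. W n \<sigma> * (real (X n \<sigma>) ^ k * falling (X n \<sigma>) r)))
        \<longlonglongrightarrow> w * (d + real r * c)"
        using tendsto_add[OF d(2) tendsto_mult_left[OF c(2), of "real r"]] by (simp add: algebra_simps)
      show "\<forall>\<^sub>F n in sequentially.
        measure_pmf.expectation (P n) (\<lambda>\<sigma>. W n \<sigma> * (real (X n \<sigma>) ^ k * falling (X n \<sigma>) (Suc r))) +
          real r * measure_pmf.expectation (P n) (\<lambda>\<sigma>. W n \<sigma> * (real (X n \<sigma>) ^ k * falling (X n \<sigma>) r)) =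
        measure_pmf.expectation (P n) (\<lambda>\<sigma>. W n \<sigma> * (real (X n \<sigma>) ^ Suc k * falling (X n \<sigma>) r))"
        using fin
      proof eventually_elim
        case (elim n)
        note int = integrable_measure_pmf_finite[OF elim]
        show ?case
          unfolding eq distrib_left mult.left_commute[of _ "real r"]
          by (simp add: Bochner_Integration.integral_add[OF int int])
      qed
    qed
    ultimately show ?case by blast
  qed
  from this[of k 0] show ?thesis by (auto dest: has_bochner_integral_integral_eq)
qed

section \<open>Point probabilities from truncated alternating sums\<close>

text \<open>With \<open>falling c m\<close> factored out, this is the closed form of a truncated
  alternating row sum of binomial coefficients. The generalized coefficient also covers the upper
  index \<open>-1\<close>, which arises for \<open>c = m\<close>.\<close>

lemma bonferroni_identity:
  "(\<Sum>j\<le>J. (-1) ^ j * falling c (m + j) / (fact m * fact j)) =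
   falling c m / fact m * ((-1) ^ J * ((real c - real m - 1) gchoose J))"
proof -
  have "(-1) ^ j * falling c (m + j) / (fact m * fact j) =
    falling c m / fact m * (((real c - real m) gchoose j) * (-1) ^ j)" for j
    by (simp add: falling_add gbinomial_prod_rev atLeast0LessThan)
  then show ?thesis by (simp only: sum_distrib_left[symmetric] gbinomial_sum_lower_neg)
qed

text \<open>For \<open>c > m\<close> the closed form is \<open>(-1) ^ J\<close> times a nonnegative
  number. For \<open>c = m\<close> it is exactly 1, because \<open>(-1) gchoose J\<close> is
  \<open>(-1) ^ J\<close>, and for \<open>c < m\<close> it is 0.\<close>

lemma bonferroni:
  fixes c m J :: nat
  defines "S \<equiv> (\<Sum>j\<le>J. (-1) ^ j * falling c (m + j) / (fact m * fact j))"
  shows "even J \<Longrightarrow> of_bool (c = m) \<le> S" "odd J \<Longrightarrow> S \<le> of_bool (c = m)"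
proof -
  consider "c < m" | "c = m" | "c > m" by linarith
  then have "(even J \<longrightarrow> of_bool (c = m) \<le> S) \<and> (odd J \<longrightarrow> S \<le> of_bool (c = m))"
  proof cases
    case 1
    then show ?thesis by (simp add: S_def bonferroni_identity falling_eq_0)
  next
    case 2
    have "falling m m = fact m" using falling_ge[of m 0] by simp
    moreover have "(-1 :: real) gchoose J = (-1) ^ J"
      using gbinomial_minus[of "1 :: real" J] by (simp add: binomial_gbinomial[symmetric])
    ultimately have "S = (-1) ^ J * (-1) ^ J"
      using 2 unfolding S_def bonferroni_identity by simp
    then have "S = 1" by (simp flip: power_mult_distrib)
    then show ?thesis using 2 by simp
  next
    case 3
    have "real c - real m - 1 = real (c - m - 1)" using 3 by simp
    then have "((real c - real m - 1) gchoose J) \<ge> 0"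
      by (metis binomial_gbinomial of_nat_0_le_iff)
    then have "falling c m / fact m * ((real c - real m - 1) gchoose J) \<ge> 0"
      by (simp add: falling_nonneg)
    then show ?thesis using 3 by (auto simp: S_def bonferroni_identity)
  qed
  then show "even J \<Longrightarrow> of_bool (c = m) \<le> S" "odd J \<Longrightarrow> S \<le> of_bool (c = m)" by auto
qed

text \<open>For each \<open>J\<close> the weighted Bonferroni sums bound the target on one side;
  they converge in \<open>n\<close> to \<open>w * q J\<close>, and \<open>q J\<close> tends to the
  Poisson probability as \<open>J\<close> grows.\<close>

lemma weighted_point_limit:
  fixes P :: "nat \<Rightarrow> 'b pmf" and X :: "nat \<Rightarrow> 'b \<Rightarrow> nat" and W :: "nat \<Rightarrow> 'b \<Rightarrow> real"
  assumes "\<mu> > 0" and fin: "\<forall>\<^sub>F n in sequentially. finite (set_pmf (P n))"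
    and W: "\<And>n \<sigma>. W n \<sigma> \<ge> 0"
    and lim: "\<And>r. (\<lambda>n. measure_pmf.expectation (P n) (\<lambda>\<sigma>. W n \<sigma> * falling (X n \<sigma>) r)) \<longlonglongrightarrow> w * \<mu> ^ r"
  shows "(\<lambda>n. measure_pmf.expectation (P n) (\<lambda>\<sigma>. W n \<sigma> * of_bool (X n \<sigma> = m))) \<longlonglongrightarrow>
    w * pmf (poisson_pmf \<mu>) m"
proof -
  let ?a = "\<lambda>n. measure_pmf.expectation (P n) (\<lambda>\<sigma>. W n \<sigma> * of_bool (X n \<sigma> = m))"
  define S where "S J c = (\<Sum>j\<le>J. (-1) ^ j * falling c (m + j) / (fact m * fact j))" for J c
  define q where "q J = (\<Sum>j\<le>J. (-1) ^ j * \<mu> ^ (m + j) / (fact m * fact j))" for J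
  let ?b = "\<lambda>J n. measure_pmf.expectation (P n) (\<lambda>\<sigma>. W n \<sigma> * S J (X n \<sigma>))"
  have b: "?b J \<longlonglongrightarrow> w * q J" for J
  proof (rule Lim_transform_eventually)
    let ?e = "\<lambda>n j. measure_pmf.expectation (P n) (\<lambda>\<sigma>. W n \<sigma> * falling (X n \<sigma>) (m + j))"
    have "(\<lambda>n. \<Sum>j\<le>J. (-1) ^ j / (fact m * fact j) * ?e n j) \<longlonglongrightarrow>
      (\<Sum>j\<le>J. (-1) ^ j / (fact m * fact j) * (w * \<mu> ^ (m + j)))"
      by (intro tendsto_intros lim)
    then show "(\<lambda>n. \<Sum>j\<le>J. (-1) ^ j / (fact m * fact j) * ?e n j) \<longlonglongrightarrow> w * q J"
      by (simp add: q_def sum_distrib_left mult_ac)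
    show "\<forall>\<^sub>F n in sequentially. (\<Sum>j\<le>J. (-1) ^ j / (fact m * fact j) * ?e n j) = ?b J n"
      using fin
    proof eventually_elim
      case (elim n)
      note int = integrable_measure_pmf_finite[OF elim]
      have "?b J n = measure_pmf.expectation (P n)
        (\<lambda>\<sigma>. \<Sum>j\<le>J. (-1) ^ j / (fact m * fact j) * (W n \<sigma> * falling (X n \<sigma>) (m + j)))"
        by (simp add: S_def sum_distrib_left mult_ac)
      also have "\<dots> = (\<Sum>j\<le>J. (-1) ^ j / (fact m * fact j) * ?e n j)"
        by (subst Bochner_Integration.integral_sum[OF int]) simp
      finally show ?case by simp
    qed
  qed
  have q: "q \<longlonglongrightarrow> pmf (poisson_pmf \<mu>) m"
  proof -
    have "(\<lambda>j. (-\<mu>) ^ j / fact j) sums exp (-\<mu>)"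
      using exp_converges[of "-\<mu>"] by (simp add: scaleR_conv_of_real divide_inverse mult.commute)
    then have "(\<lambda>j. \<mu> ^ m / fact m * ((-\<mu>) ^ j / fact j)) sums (\<mu> ^ m / fact m * exp (-\<mu>))"
      by (rule sums_mult)
    moreover have "\<mu> ^ m / fact m * ((-\<mu>) ^ j / fact j) = (-1) ^ j * \<mu> ^ (m + j) / (fact m * fact j)" for j
      by (subst power_minus) (simp add: power_add)
    ultimately show ?thesis using \<open>\<mu> > 0\<close> unfolding sums_def_le q_def by simp
  qed
  then have wq: "(\<lambda>J. w * q J) \<longlonglongrightarrow> w * pmf (poisson_pmf \<mu>) m"
    by (rule tendsto_mult_left)
  have ord: "(even J \<longrightarrow> ?a n \<le> ?b J n) \<and> (odd J \<longrightarrow> ?b J n \<le> ?a n)"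
    if "finite (set_pmf (P n))" for J n
    using integrable_measure_pmf_finite[OF that] W bonferroni unfolding S_def
    by (auto intro!: integral_mono mult_left_mono)
  show ?thesis
  proof (rule order_tendstoI)
    fix y assume "y < w * pmf (poisson_pmf \<mu>) m"
    then have "\<forall>\<^sub>F J in sequentially. y < w * q J" using order_tendstoD(1)[OF wq] by blast
    then obtain N where N: "\<And>J. J \<ge> N \<Longrightarrow> y < w * q J" by (auto simp: eventually_sequentially)
    \<comment> \<open>An odd index beyond \<open>N\<close>, since odd truncations bound from below;
      the upper bound below uses the even index \<open>2 * N\<close>.\<close>
    have "\<forall>\<^sub>F n in sequentially. y < ?b (2 * N + 1) n"
      by (rule order_tendstoD(1)[OF b]) (rule N, simp)
    then show "\<forall>\<^sub>F n in sequentially. y < ?a n"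
      using fin by eventually_elim (use ord[of _ "2 * N + 1"] in fastforce)
  next
    fix y assume "y > w * pmf (poisson_pmf \<mu>) m"
    then have "\<forall>\<^sub>F J in sequentially. y > w * q J" using order_tendstoD(2)[OF wq] by blast
    then obtain N where N: "\<And>J. J \<ge> N \<Longrightarrow> y > w * q J" by (auto simp: eventually_sequentially)
    have "\<forall>\<^sub>F n in sequentially. y > ?b (2 * N) n"
      by (rule order_tendstoD(2)[OF b]) (rule N, simp)
    then show "\<forall>\<^sub>F n in sequentially. y > ?a n"
      using fin by eventually_elim (use ord[of _ "2 * N"] in fastforce)
  qed
qed

text \<open>The falling factorials are replaced by \<open>g\<close> one coordinate at a time; at each step the product
  over the other coordinates plays the role of the weight \<open>W\<close>.\<close>

lemma joint_limit_by_coordinates: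
  fixes P :: "nat \<Rightarrow> 'b pmf" and X :: "nat \<Rightarrow> 'i \<Rightarrow> 'b \<Rightarrow> nat" and g :: "'i \<Rightarrow> nat \<Rightarrow> real"
  assumes "finite A" and g: "\<And>a x. g a x \<ge> 0"
    and moments: "\<And>r. (\<lambda>n. measure_pmf.expectation (P n) (\<lambda>\<sigma>. \<Prod>a\<in>A. falling (X n a \<sigma>) (r a)))
      \<longlonglongrightarrow> (\<Prod>a\<in>A. \<mu> a ^ r a)"
    and coordinate: "\<And>a W w. a \<in> A \<Longrightarrow> (\<And>n \<sigma>. W n \<sigma> \<ge> (0::real)) \<Longrightarrow>
      (\<And>r. (\<lambda>n. measure_pmf.expectation (P n) (\<lambda>\<sigma>. W n \<sigma> * falling (X n a \<sigma>) r)) \<longlonglongrightarrow> w * \<mu> a ^ r) \<Longrightarrow>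
      (\<lambda>n. measure_pmf.expectation (P n) (\<lambda>\<sigma>. W n \<sigma> * g a (X n a \<sigma>))) \<longlonglongrightarrow> w * G a"
  shows "(\<lambda>n. measure_pmf.expectation (P n) (\<lambda>\<sigma>. \<Prod>a\<in>A. g a (X n a \<sigma>))) \<longlonglongrightarrow> (\<Prod>a\<in>A. G a)"
proof -
  \<comment> \<open>The orders \<open>r\<close> stay arbitrary: converting coordinate
    \<open>b\<close> requires all orders \<open>s\<close> at \<open>b\<close>, obtained from the
    induction hypothesis at \<open>r(b := s)\<close>.\<close>
  have "(\<lambda>n. measure_pmf.expectation (P n) (\<lambda>\<sigma>. (\<Prod>a\<in>B. g a (X n a \<sigma>)) * (\<Prod>a\<in>A-B. falling (X n a \<sigma>) (r a))))
      \<longlonglongrightarrow> (\<Prod>a\<in>B. G a) * (\<Prod>a\<in>A-B. \<mu> a ^ r a)" if "B \<subseteq> A" for B r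
    using finite_subset[OF that \<open>finite A\<close>] that
  proof (induction B arbitrary: r rule: finite_induct)
    case empty
    then show ?case using moments[of r] by simp
  next
    case (insert b B)
    have AB: "A - B = insert b (A - insert b B)" using insert by auto
    let ?C = "A - insert b B"
    define W where "W n \<sigma> = (\<Prod>a\<in>B. g a (X n a \<sigma>)) * (\<Prod>a\<in>?C. falling (X n a \<sigma>) (r a))" for n \<sigma>
    define w where "w = (\<Prod>a\<in>B. G a) * (\<Prod>a\<in>?C. \<mu> a ^ r a)"
    have "(\<lambda>n. measure_pmf.expectation (P n) (\<lambda>\<sigma>. W n \<sigma> * g b (X n b \<sigma>))) \<longlonglongrightarrow> w * G b"
    proof (rule coordinate)
      show "b \<in> A" using insert by simp
      show "W n \<sigma> \<ge> 0" for n \<sigma>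
        unfolding W_def by (intro mult_nonneg_nonneg prod_nonneg) (auto simp: g falling_nonneg)
      fix s
      have 1: "(\<Prod>a\<in>A-B. f a ((r(b := s)) a)) = f b s * (\<Prod>a\<in>?C. f a (r a))" for f :: "'i \<Rightarrow> nat \<Rightarrow> real"
      proof -
        have "(\<Prod>a\<in>?C. f a ((r(b := s)) a)) = (\<Prod>a\<in>?C. f a (r a))"
          by (rule prod.cong) auto
        then show ?thesis unfolding AB using \<open>finite A\<close> by (subst prod.insert) auto
      qed
      have "(\<lambda>n. measure_pmf.expectation (P n) (\<lambda>\<sigma>. (\<Prod>a\<in>B. g a (X n a \<sigma>)) * (\<Prod>a\<in>A-B. falling (X n a \<sigma>) ((r(b := s)) a))))
        \<longlonglongrightarrow> (\<Prod>a\<in>B. G a) * (\<Prod>a\<in>A-B. \<mu> a ^ ((r(b := s)) a))"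
        using insert by blast
      then show "(\<lambda>n. measure_pmf.expectation (P n) (\<lambda>\<sigma>. W n \<sigma> * falling (X n b \<sigma>) s)) \<longlonglongrightarrow> w * \<mu> b ^ s"
        unfolding 1[of "\<lambda>a k. falling (X _ a _) k"] 1[of "\<lambda>a k. \<mu> a ^ k"] by (simp add: W_def w_def mult_ac)
    qed
    then show ?case using insert by (simp add: W_def w_def mult_ac)
  qed
  from this[of A] show ?thesis by simp
qed

section \<open>Riemann sums on the unit cube\<close>

abbreviation unit_measure :: "real measure" where
  "unit_measure \<equiv> restrict_space lborel {0..1}"

lemma prob_space_unit_measure: "prob_space unit_measure"
  by (rule prob_spaceI) (simp add: emeasure_restrict_space)

text \<open>The maximum with \<open>1\<close> puts the point \<open>0\<close> into the first bucket, so that every point of the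
  unit interval has an index in \<open>{1..n}\<close>.\<close>

definition bucket :: "nat \<Rightarrow> real \<Rightarrow> nat" where
  "bucket n x = max 1 (nat \<lceil>real n * x\<rceil>)"

lemma bucket_bounds:
  assumes "x \<in> {0..1}" "n > 0"
  shows "bucket n x \<in> {1..n}" "\<bar>real (bucket n x) / real n - x\<bar> \<le> 1 / real n"
proof -
  have nx: "0 \<le> real n * x" "real n * x \<le> real n"
    using assms by (auto simp: mult_left_le)
  then have c: "0 \<le> \<lceil>real n * x\<rceil>" "\<lceil>real n * x\<rceil> \<le> int n"
    by (auto simp: ceiling_le_iff)
  then show "bucket n x \<in> {1..n}" using assms by (auto simp: bucket_def)
  have "\<bar>real (bucket n x) - real n * x\<bar> \<le> 1"
    using nx c(1) unfolding bucket_def by (auto simp: max_def abs_le_iff split: if_splits) linarith+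
  moreover have "\<bar>real (bucket n x) / real n - x\<bar> = \<bar>real (bucket n x) - real n * x\<bar> / real n"
    using assms(2) by (simp add: field_simps abs_divide flip: abs_of_pos)
  ultimately show "\<bar>real (bucket n x) / real n - x\<bar> \<le> 1 / real n"
    using assms(2) by (simp add: divide_right_mono)
qed

lemma bucket_eq_iff:
  assumes "x \<in> {0..1}" "n > 0" "v \<in> {1..n}"
  shows "bucket n x = v \<longleftrightarrow> x \<in> (if v = 1 then {0..1 / real n} else {(real v - 1) / real n<..real v / real n})"
proof -
  have nx: "0 \<le> real n * x" using assms by simp
  have "bucket n x = v \<longleftrightarrow> (if v = 1 then real n * x \<le> 1 else real v - 1 < real n * x \<and> real n * x \<le> real v)"
    using nx assms(3) unfolding bucket_def by (auto simp: max_def split: if_splits) linarith+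
  then show ?thesis using assms by (auto simp: field_simps)
qed

text \<open>Every cell has length \<open>1 / real n\<close>, the first one too despite its extra
  endpoint; these lengths become the weights of the Riemann sum.\<close>

lemma bucket_indicator:
  assumes "n > 0" "v \<in> {1..n}"
  shows "integrable unit_measure (\<lambda>x. of_bool (bucket n x = v) :: real)" (is ?I)
    and "integral\<^sup>L unit_measure (\<lambda>x. of_bool (bucket n x = v)) = 1 / real n" (is ?V)
proof -
  let ?B = "if v = 1 then {0..1 / real n} else {(real v - 1) / real n<..real v / real n}"
  have sub: "?B \<subseteq> {0..1}"
  proof -
    have "0 \<le> (real v - 1) / real n" "real v / real n \<le> 1" "1 / real n \<le> 1" using assms by auto
    then show ?thesis by (auto simp del: zero_le_divide_iff divide_le_eq_1_pos)
  qed
  have m: "measure lborel ?B = 1 / real n"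
  proof (cases "v = 1")
    case False
    have "(real v - 1) / real n \<le> real v / real n" by (simp add: divide_right_mono)
    then show ?thesis using False by (simp add: diff_divide_distrib)
  qed simp
  have eq: "of_bool (bucket n x = v) = (indicator ?B x :: real)" if "x \<in> space unit_measure" for x
    using bucket_eq_iff[of x n v] assms that by (simp add: space_restrict_space indicator_def)
  have i: "integrable lborel (indicator ?B :: real \<Rightarrow> real)"
    by (rule integrable_real_indicator) (simp, rule emeasure_bounded_finite[OF bounded_subset[OF bounded_closed_interval sub]])
  have s: "indicator {0..1} x *\<^sub>R indicator ?B x = (indicator ?B x :: real)" for x
    using sub by (auto simp: indicator_def simp del: atLeastAtMost_iff)
  have "integrable unit_measure (indicator ?B :: real \<Rightarrow> real)"
    using i by (subst integrable_restrict_space) (auto simp only: set_integrable_def s, simp_all)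
  then show ?I by (subst Bochner_Integration.integrable_cong[OF refl eq])
  have "integral\<^sup>L unit_measure (indicator ?B :: real \<Rightarrow> real) = 1 / real n"
    using m by (subst integral_restrict_space) (simp_all only: set_lebesgue_integral_def s, simp_all)
  then show ?V by (subst Bochner_Integration.integral_cong[OF refl eq])
qed

text \<open>The Riemann sum is the integral of the step function obtained by rounding each coordinate up to
  the grid, so dominated convergence applies. Continuity is assumed sequentially in the first \<open>a\<close>
  coordinates; in particular \<open>F\<close> does not depend on the others.\<close>

lemma riemann_sum_cube:
  fixes F :: "(nat \<Rightarrow> real) \<Rightarrow> real"
  assumes cont: "\<And>X x. (\<And>n i. i < a \<Longrightarrow> X n i \<in> {0..1}) \<Longrightarrow> (\<And>i. i < a \<Longrightarrow> x i \<in> {0..1}) \<Longrightarrow>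
      (\<And>i. i < a \<Longrightarrow> (\<lambda>n. X n i) \<longlonglongrightarrow> x i) \<Longrightarrow> (\<lambda>n. F (X n)) \<longlonglongrightarrow> F x"
    and bounded: "\<And>x. (\<And>i. i < a \<Longrightarrow> x i \<in> {0..1}) \<Longrightarrow> \<bar>F x\<bar> \<le> K"
  shows "(\<lambda>n. (\<Sum>v\<in>{..<a} \<rightarrow>\<^sub>E {1..n}. F (\<lambda>i. real (v i) / real n)) / real n ^ a)
      \<longlonglongrightarrow> (\<integral>x. F x \<partial>(PiM {..<a} (\<lambda>_. unit_measure)))"
    and "integrable (PiM {..<a} (\<lambda>_. unit_measure)) F"
proof -
  let ?M = "PiM {..<a} (\<lambda>_. unit_measure)"
  interpret U: prob_space unit_measure by (rule prob_space_unit_measure)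
  interpret product_prob_space "\<lambda>_ :: nat. unit_measure" "{..<a}" ..
  have cube: "x i \<in> {0..1}" if "x \<in> space ?M" "i < a" for x i
    using that by (auto simp: space_PiM space_restrict_space PiE_def Pi_def simp del: atLeastAtMost_iff)
  \<comment> \<open>The indicator of the grid cell with index \<open>v\<close>, written as a product
    so that its integral factors over coordinates.\<close>
  define g where "g N v x = (\<Prod>i<a. of_bool (bucket N (x i) = v i) :: real)" for N v and x :: "nat \<Rightarrow> real"
  define G where "G N x = (\<Sum>v\<in>{..<a} \<rightarrow>\<^sub>E {1..N}. F (\<lambda>i. real (v i) / real N) * g N v x)" for N x
  have g: "integrable ?M (g N v)" "integral\<^sup>L ?M (g N v) = (1 / real N) ^ a"
    if "N > 0" "v \<in> {..<a} \<rightarrow>\<^sub>E {1..N}" for N v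
  proof -
    have v: "v i \<in> {1..N}" if "i \<in> {..<a}" for i using that \<open>v \<in> _\<close> by (rule PiE_mem[rotated])
    show "integrable ?M (g N v)" unfolding g_def
      by (rule product_integrable_prod) (use bucket_indicator(1)[OF \<open>N > 0\<close> v] in auto)
    have "integral\<^sup>L ?M (g N v) = (\<Prod>i<a. integral\<^sup>L unit_measure (\<lambda>x. of_bool (bucket N x = v i)))"
      unfolding g_def
      by (rule product_integral_prod) (use bucket_indicator(1)[OF \<open>N > 0\<close> v] in auto)
    also have "\<dots> = (\<Prod>i<a. 1 / real N)"
      by (rule prod.cong) (use bucket_indicator(2)[OF \<open>N > 0\<close> v] in auto)
    finally show "integral\<^sup>L ?M (g N v) = (1 / real N) ^ a" by simp
  qed
  have intG: "integrable ?M (G N)" if "N > 0" for N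
    unfolding G_def using g(1)[OF that] by (intro Bochner_Integration.integrable_sum integrable_mult_right) auto
  have valG: "integral\<^sup>L ?M (G N) = (\<Sum>v\<in>{..<a} \<rightarrow>\<^sub>E {1..N}. F (\<lambda>i. real (v i) / real N)) / real N ^ a"
    if "N > 0" for N
    unfolding G_def using g[OF that]
    by (subst Bochner_Integration.integral_sum) (auto simp: sum_distrib_right power_inverse divide_inverse)
  \<comment> \<open>The restriction matches the extensional indices \<open>v\<close>. From
    \<open>a\<close> on the value is arbitrary, which is harmless as \<open>cont\<close> and
    \<open>bounded\<close> only constrain coordinates below \<open>a\<close>.\<close>
  define y where "y N x = (\<lambda>i. real (restrict (\<lambda>i. bucket N (x i)) {..<a} i) / real N)" for N and x :: "nat \<Rightarrow> real"
  have G: "G N x = F (y N x)" if "N > 0" "x \<in> space ?M" for N x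
  proof -
    let ?v = "restrict (\<lambda>i. bucket N (x i)) {..<a}"
    have "?v \<in> {..<a} \<rightarrow>\<^sub>E {1..N}"
      using bucket_bounds(1)[OF cube[OF that(2)] that(1)] by (simp del: atLeastAtMost_iff)
    moreover have "g N v x = of_bool (v = ?v)" if "v \<in> {..<a} \<rightarrow>\<^sub>E {1..N}" for v
    proof (cases "v = ?v")
      case False
      then obtain i where "v i \<noteq> ?v i" by (auto simp: fun_eq_iff)
      moreover from this have "i < a" using PiE_arb[OF that, of i] by (cases "i < a") auto
      ultimately show ?thesis using False unfolding g_def by (auto intro!: prod_zero bexI[of _ i])
    qed (simp add: g_def)
    ultimately have "G N x = (\<Sum>v\<in>{..<a} \<rightarrow>\<^sub>E {1..N}. if v = ?v then F (\<lambda>i. real (v i) / real N) else 0)"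
      unfolding G_def by (intro sum.cong) auto
    also have "\<dots> = F (y N x)"
      using \<open>?v \<in> _\<close> unfolding y_def by (subst sum.delta) (auto intro!: finite_PiE simp del: PiE_iff restrict_PiE_iff)
    finally show ?thesis .
  qed
  have y: "y N x i \<in> {0..1}" if "N > 0" "x \<in> space ?M" "i < a" for N x i
    using bucket_bounds(1)[OF cube[OF that(2,3)] that(1)] that by (simp add: y_def)
  \<comment> \<open>The shift to \<open>Suc n\<close> keeps the mesh defined;
    \<open>LIMSEQ_imp_Suc\<close> removes it at the end.\<close>
  have lim: "(\<lambda>n. G (Suc n) x) \<longlonglongrightarrow> F x" if x: "x \<in> space ?M" for x
    unfolding G[OF zero_less_Suc x]
  proof (rule cont)
    fix i assume i: "i < a"
    show "x i \<in> {0..1}" using cube[OF x i] .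
    show "y (Suc n) x i \<in> {0..1}" for n using y[OF _ x i] by blast
    have "(\<lambda>n. y (Suc n) x i - x i) \<longlonglongrightarrow> 0"
    proof (rule tendsto_rabs_zero_cancel, rule tendsto_sandwich[OF _ _ tendsto_const LIMSEQ_inverse_real_of_nat])
      show "\<forall>\<^sub>F n in sequentially. \<bar>y (Suc n) x i - x i\<bar> \<le> inverse (real (Suc n))"
        using bucket_bounds(2)[OF cube[OF x i], of "Suc _"] i
        by (intro always_eventually allI) (simp add: y_def divide_inverse)
    qed simp
    then show "(\<lambda>n. y (Suc n) x i) \<longlonglongrightarrow> x i" using Lim_null by blast
  qed
  \<comment> \<open>Measurability is inherited from the step functions through the pointwise
    limit.\<close>
  have meas: "F \<in> borel_measurable ?M"
    by (rule borel_measurable_LIMSEQ_real[OF lim]) (use intG in auto)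
  have bnd: "AE x in ?M. norm (G (Suc n) x) \<le> K" for n
    using G[of "Suc n"] bounded[OF y[of "Suc n"]] by (intro AE_I2) simp
  have K: "integrable ?M (\<lambda>_. K)" by simp
  have AElim: "AE x in ?M. (\<lambda>n. G (Suc n) x) \<longlonglongrightarrow> F x" using lim by (intro AE_I2)
  have mG: "G (Suc n) \<in> borel_measurable ?M" for n using intG by auto
  show "integrable ?M F" by (rule integrable_dominated_convergence[OF meas mG K AElim bnd])
  have "(\<lambda>n. integral\<^sup>L ?M (G (Suc n))) \<longlonglongrightarrow> integral\<^sup>L ?M F"
    by (rule integral_dominated_convergence[OF meas mG K AElim bnd])
  then show "(\<lambda>n. (\<Sum>v\<in>{..<a} \<rightarrow>\<^sub>E {1..n}. F (\<lambda>i. real (v i) / real n)) / real n ^ a) \<longlonglongrightarrow> integral\<^sup>L ?M F"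
    unfolding valG[OF zero_less_Suc] by (rule LIMSEQ_imp_Suc)
qed

section \<open>Convergence of the factorial moments\<close>

lemma in_C_bounds:
  assumes "in_C \<rho>"
  obtains \<delta> K where "\<delta> > 0" "\<And>x y. x \<in> {0..1} \<Longrightarrow> y \<in> {0..1} \<Longrightarrow> \<delta> \<le> \<rho> x y \<and> \<rho> x y \<le> K"
proof -
  let ?Q = "{0..1::real} \<times> {0..1::real}"
  have c: "continuous_on ?Q (\<lambda>(x, y). \<rho> x y)" and pos: "\<And>x y. x \<in> {0..1} \<Longrightarrow> y \<in> {0..1} \<Longrightarrow> \<rho> x y > 0"
    using assms unfolding in_C_def by blast+
  have Q: "compact ?Q" "?Q \<noteq> {}" by (auto intro: compact_Times)
  obtain a where a: "a \<in> ?Q" "\<And>b. b \<in> ?Q \<Longrightarrow> (case a of (x, y) \<Rightarrow> \<rho> x y) \<le> (case b of (x, y) \<Rightarrow> \<rho> x y)"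
    using continuous_attains_inf[OF Q c] by blast
  obtain d where d: "d \<in> ?Q" "\<And>b. b \<in> ?Q \<Longrightarrow> (case b of (x, y) \<Rightarrow> \<rho> x y) \<le> (case d of (x, y) \<Rightarrow> \<rho> x y)"
    using continuous_attains_sup[OF Q c] by blast
  show thesis
  proof (rule that)
    show "(case a of (x, y) \<Rightarrow> \<rho> x y) > 0" using a(1) pos by auto
    show "(case a of (x, y) \<Rightarrow> \<rho> x y) \<le> \<rho> x y \<and> \<rho> x y \<le> (case d of (x, y) \<Rightarrow> \<rho> x y)"
      if "x \<in> {0..1}" "y \<in> {0..1}" for x y
      using a(2)[of "(x, y)"] d(2)[of "(x, y)"] that by auto
  qed
qed

definition pair_weight :: "(real \<Rightarrow> real \<Rightarrow> real) \<Rightarrow> nat \<Rightarrow> nat list \<Rightarrow> nat list \<Rightarrow> real" where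
  "pair_weight \<rho> n p q = (\<Prod>i<length p. \<rho> (real (p ! i) / real n) (real (q ! i) / real n))"

text \<open>Repetitions are allowed, so concatenation of blocks identifies the grid with a product
  of smaller grids.\<close>

definition lists_upto :: "nat \<Rightarrow> nat \<Rightarrow> nat list set" where
  "lists_upto n l = {p. set p \<subseteq> {1..n} \<and> length p = l}"

lemma finite_lists_upto [simp]: "finite (lists_upto n l)"
  by (simp add: lists_upto_def finite_lists_length_eq)

lemma card_lists_upto: "card (lists_upto n l) = n ^ l"
  by (simp add: lists_upto_def card_lists_length_eq)

lemma pair_weight_append:
  assumes "length p = length q"
  shows "pair_weight \<rho> n (p @ p') (q @ q') = pair_weight \<rho> n p q * pair_weight \<rho> n p' q'"
proof -
  let ?f = "\<lambda>i. \<rho> (real ((p @ p') ! i) / real n) (real ((q @ q') ! i) / real n)"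
  have "pair_weight \<rho> n (p @ p') (q @ q') = prod ?f {..<length p + length p'}"
    by (simp add: pair_weight_def)
  also have "\<dots> = prod ?f {..<length p} * prod ?f {length p..<length p + length p'}"
    by (subst prod.union_disjoint[symmetric]) (auto intro!: prod.cong)
  also have "prod ?f {length p..<length p + length p'} = (\<Prod>i<length p'. ?f (i + length p))"
    by (rule prod.reindex_bij_witness[of _ "\<lambda>i. i + length p" "\<lambda>i. i - length p"]) auto
  finally show ?thesis using assms by (simp add: pair_weight_def nth_append)
qed

lemma unit_grid: "v \<in> {1..n} \<Longrightarrow> real v / real n \<in> {0..1}"
  by auto

lemma pair_weight_bounds:
  assumes "\<And>x y. x \<in> {0..1} \<Longrightarrow> y \<in> {0..1} \<Longrightarrow> \<delta> \<le> \<rho> x y \<and> \<rho> x y \<le> K" "\<delta> > 0"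
    and "p \<in> lists_upto n l" "q \<in> lists_upto n l"
  shows "0 < pair_weight \<rho> n p q" "pair_weight \<rho> n p q \<le> K ^ l"
proof -
  have r: "\<delta> \<le> \<rho> (real (p ! i) / real n) (real (q ! i) / real n) \<and>
      \<rho> (real (p ! i) / real n) (real (q ! i) / real n) \<le> K" if "i < length p" for i
    using that assms(3,4) by (intro assms(1) unit_grid) (auto simp: lists_upto_def subset_iff simp del: atLeastAtMost_iff)
  show "0 < pair_weight \<rho> n p q"
    unfolding pair_weight_def using r \<open>\<delta> > 0\<close> by (intro prod_pos) (auto intro: less_le_trans)
  have "pair_weight \<rho> n p q \<le> (\<Prod>i<length p. K)"
    unfolding pair_weight_def using r \<open>\<delta> > 0\<close> by (intro prod_mono) (auto intro: order_trans[OF less_imp_le])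
  then show "pair_weight \<rho> n p q \<le> K ^ l" using assms(3) by (simp add: lists_upto_def)
qed

lemma rotate_blocks_lists_upto:
  assumes "p \<in> lists_upto n (sum_list as)"
  shows "rotate_blocks as p \<in> lists_upto n (sum_list as)"
proof -
  have "mset (rotate_blocks as p) = mset p"
    using assms by (intro mset_rotate_blocks) (simp add: lists_upto_def)
  from mset_eq_setD[OF this] mset_eq_length[OF this] show ?thesis
    using assms by (simp add: lists_upto_def)
qed

text \<open>On the full grid the blocks vary independently and \<open>pair_weight\<close> is
  multiplicative under concatenation.\<close>

lemma sum_pair_weight_blocks:
  "(\<Sum>p\<in>lists_upto n (sum_list as). pair_weight \<rho> n p (rotate_blocks as p)) =
   (\<Prod>a\<leftarrow>as. \<Sum>x\<in>lists_upto n a. pair_weight \<rho> n x (rotate1 x))"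
proof (induction as)
  case Nil
  have "lists_upto n 0 = {[]}" by (auto simp: lists_upto_def)
  then show ?case by (simp add: pair_weight_def)
next
  case (Cons a as)
  let ?w = "\<lambda>p. pair_weight \<rho> n p (rotate_blocks as p)" and ?c = "\<lambda>x. pair_weight \<rho> n x (rotate1 x)"
  have "(\<Prod>a\<leftarrow>a # as. \<Sum>x\<in>lists_upto n a. ?c x) =
      (\<Sum>(x, p)\<in>lists_upto n a \<times> lists_upto n (sum_list as). ?c x * ?w p)"
    unfolding sum.cartesian_product[symmetric] by (simp add: sum_product flip: Cons)
  also have "\<dots> = (\<Sum>p\<in>lists_upto n (sum_list (a # as)). pair_weight \<rho> n p (rotate_blocks (a # as) p))"
  proof (rule sum.reindex_bij_witness[of _ "\<lambda>p. (take a p, drop a p)" "\<lambda>(x, p). x @ p"], goal_cases)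
    case (3 p)
    then show ?case by (auto simp: lists_upto_def dest: in_set_takeD in_set_dropD)
  next
    case (5 xp)
    then obtain x p where "xp = (x, p)" "length x = a" by (auto simp: lists_upto_def)
    then show ?case by (simp add: pair_weight_append)
  next
    case (4 p)
    then show ?case by (auto simp: lists_upto_def subset_iff dest: in_set_takeD in_set_dropD simp del: atLeastAtMost_iff)
  qed (auto simp: lists_upto_def)
  finally show ?case by simp
qed

lemma cycle_integrand_continuous:
  assumes "in_C \<rho>"
    and X: "\<And>n i. i < a \<Longrightarrow> X n i \<in> {0..1}" and x: "\<And>i. i < a \<Longrightarrow> x i \<in> {0..1}"
    and lim: "\<And>i. i < a \<Longrightarrow> (\<lambda>n. X n i) \<longlonglongrightarrow> x i"
  shows "(\<lambda>n. \<Prod>i<a. \<rho> (X n i) (X n (Suc i mod a))) \<longlonglongrightarrow> (\<Prod>i<a. \<rho> (x i) (x (Suc i mod a)))"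
proof (rule tendsto_prod)
  fix i assume "i \<in> {..<a}"
  then have i: "i < a" "Suc i mod a < a" by auto
  have c: "continuous_on ({0..1} \<times> {0..1}) (\<lambda>(x, y). \<rho> x y)"
    using assms(1) unfolding in_C_def by blast
  have "(\<lambda>n. case (X n i, X n (Suc i mod a)) of (x, y) \<Rightarrow> \<rho> x y) \<longlonglongrightarrow>
      (case (x i, x (Suc i mod a)) of (x, y) \<Rightarrow> \<rho> x y)"
  proof (rule continuous_on_tendsto_compose[OF c tendsto_Pair[OF lim[OF i(1)] lim[OF i(2)]]])
    show "(x i, x (Suc i mod a)) \<in> {0..1} \<times> {0..1}" using x i by blast
    show "\<forall>\<^sub>F n in sequentially. (X n i, X n (Suc i mod a)) \<in> {0..1} \<times> {0..1}"
      using X i by (intro always_eventually allI) blast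
  qed
  then show "(\<lambda>n. \<rho> (X n i) (X n (Suc i mod a))) \<longlonglongrightarrow> \<rho> (x i) (x (Suc i mod a))" by simp
qed

text \<open>Pairing \<open>x\<close> with \<open>rotate1 x\<close> produces the cyclic integrand of
  \<open>c_rho\<close>, so the sum is its Riemann sum; the factor \<open>a\<close> undoes the
  \<open>1 / real a\<close> in \<open>c_rho\<close>. Positivity holds because the integrand is at
  least \<open>\<delta> ^ a\<close> on a probability space.\<close>

lemma
  assumes "in_C \<rho>" "a > 0"
  shows cycle_weight_limit: "(\<lambda>n. (\<Sum>x\<in>lists_upto n a. pair_weight \<rho> n x (rotate1 x)) / real n ^ a)
      \<longlonglongrightarrow> real a * c_rho \<rho> a"
    and c_rho_pos: "c_rho \<rho> a > 0"
proof -
  let ?F = "\<lambda>x. \<Prod>i<a. \<rho> (x i) (x (Suc i mod a))"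
  let ?M = "PiM {..<a} (\<lambda>_. unit_measure)"
  obtain \<delta> K where "\<delta> > 0" and b: "\<And>x y. x \<in> {0..1} \<Longrightarrow> y \<in> {0..1} \<Longrightarrow> \<delta> \<le> \<rho> x y \<and> \<rho> x y \<le> K"
    using in_C_bounds[OF assms(1)] by blast
  have r: "\<delta> \<le> \<rho> (x i) (x (Suc i mod a)) \<and> \<rho> (x i) (x (Suc i mod a)) \<le> K"
    if "\<And>i. i < a \<Longrightarrow> x i \<in> {0..1}" "i < a" for x i
    using that by (intro b that(1)) auto
  have F: "\<delta> ^ a \<le> ?F x \<and> ?F x \<le> K ^ a" if "\<And>i. i < a \<Longrightarrow> x i \<in> {0..1}" for x
  proof -
    have "(\<Prod>i<a. \<delta>) \<le> ?F x" using r[of x, OF that] \<open>\<delta> > 0\<close> by (intro prod_mono) auto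
    moreover have "?F x \<le> (\<Prod>i<a. K)"
      using r[of x, OF that] \<open>\<delta> > 0\<close> by (intro prod_mono) (auto intro: order_trans[OF less_imp_le])
    ultimately show ?thesis by simp
  qed
  have absF: "\<bar>?F x\<bar> \<le> K ^ a" if "\<And>i. i < a \<Longrightarrow> x i \<in> {0..1}" for x
  proof -
    have "0 < \<delta> ^ a" using \<open>\<delta> > 0\<close> by simp
    then show ?thesis using F[of x, OF that] by linarith
  qed
  note riemann = riemann_sum_cube[of a ?F, OF cycle_integrand_continuous[OF assms(1)] absF]
  have I: "integral\<^sup>L ?M ?F = real a * c_rho \<rho> a" using assms(2) by (simp add: c_rho_def)
  have eq: "(\<Sum>v\<in>{..<a} \<rightarrow>\<^sub>E {1..n}. ?F (\<lambda>i. real (v i) / real n)) =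
      (\<Sum>x\<in>lists_upto n a. pair_weight \<rho> n x (rotate1 x))" for n
  proof (rule sum.reindex_bij_witness[of _ "\<lambda>x. restrict ((!) x) {..<a}" "\<lambda>v. map v [0..<a]"], goal_cases)
    case (1 v)
    show ?case
    proof
      fix i show "restrict ((!) (map v [0..<a])) {..<a} i = v i"
        using PiE_arb[OF 1, of i] by (cases "i < a") auto
    qed
  next
    case (2 v)
    then have "v i \<in> {1..n}" if "i < a" for i using that by (intro PiE_mem[OF 2]) simp
    then show ?case unfolding lists_upto_def by (auto simp del: atLeastAtMost_iff)
  next
    case (3 x)
    then have "length x = a" by (simp add: lists_upto_def)
    then show ?case by (intro nth_equalityI) auto
  next
    case (4 x)
    then have "length x = a" "set x \<subseteq> {1..n}" by (auto simp: lists_upto_def)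
    then show ?case by (auto simp: subset_iff simp del: atLeastAtMost_iff)
  next
    case (5 v)
    have "rotate1 (map v [0..<a]) ! i = v (Suc i mod a)" if "i < a" for i
      using that by (simp add: nth_rotate1 del: rotate1_map)
    then show ?case unfolding pair_weight_def by simp
  qed
  show "(\<lambda>n. (\<Sum>x\<in>lists_upto n a. pair_weight \<rho> n x (rotate1 x)) / real n ^ a)
      \<longlonglongrightarrow> real a * c_rho \<rho> a"
    by (rule riemann(1)[unfolded eq I])
  have "\<delta> ^ a \<le> integral\<^sup>L ?M ?F"
  proof (rule prob_space.integral_ge_const)
    show "prob_space ?M" by (rule prob_space_PiM) (rule prob_space_unit_measure)
    show "integrable ?M ?F" by (rule riemann(2))
    show "AE x in ?M. \<delta> ^ a \<le> ?F x"
    proof (rule AE_I2)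
      fix x assume "x \<in> space ?M"
      then have "x i \<in> {0..1}" if "i < a" for i
        using that by (auto simp: space_PiM space_restrict_space PiE_def Pi_def simp del: atLeastAtMost_iff)
      then show "\<delta> ^ a \<le> ?F x" using F by blast
    qed
  qed
  then have "\<delta> ^ a \<le> real a * c_rho \<rho> a" unfolding I .
  moreover have "\<delta> ^ a > 0" using \<open>\<delta> > 0\<close> by simp
  ultimately have "0 < real a * c_rho \<rho> a" by linarith
  then show "c_rho \<rho> a > 0" by (simp add: zero_less_mult_iff)
qed

section \<open>From all tuples to tuples of distinct points\<close>

lemma card_S_tuples: "real (card (S_tuples n l)) = falling n l"
proof (cases "l \<le> n")
  case True
  have "card (S_tuples n l) = \<Prod>{n - l + 1..n}"
    unfolding S_tuples_def using card_lists_distinct_length_eq[of "{1..n}" l] True by simp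
  also have "\<dots> = fact n div fact (n - l)" by (simp add: fact_div_fact)
  also have "real \<dots> = fact n / fact (n - l)"
    by (simp add: real_of_nat_div fact_dvd)
  also have "\<dots> = falling n l" using falling_ge[of l "n - l"] True by simp
  finally show ?thesis .
next
  case False
  have "S_tuples n l = {}"
  proof safe
    fix p assume "p \<in> S_tuples n l"
    then have "card (set p) = l" "set p \<subseteq> {1..n}"
      by (auto simp: S_tuples_def distinct_card)
    moreover from card_mono[OF _ this(2)] have "card (set p) \<le> n" by simp
    ultimately show "p \<in> {}" using False by simp
  qed
  then show ?thesis using False by (simp add: falling_eq_0)
qed

lemma falling_div_power_limit: "(\<lambda>n. falling n l / real n ^ l) \<longlonglongrightarrow> 1"
proof (rule Lim_transform_eventually)
  have "(\<lambda>n. \<Prod>i<l. 1 - real i / real n) \<longlonglongrightarrow> (\<Prod>i<l. 1 - 0)"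
    by (intro tendsto_intros lim_const_over_n)
  then show "(\<lambda>n. \<Prod>i<l. 1 - real i / real n) \<longlonglongrightarrow> 1" by simp
  show "\<forall>\<^sub>F n in sequentially. (\<Prod>i<l. 1 - real i / real n) = falling n l / real n ^ l"
    using eventually_gt_at_top[of 0]
  proof eventually_elim
    case (elim n)
    have "(\<Prod>i<l. 1 - real i / real n) = (\<Prod>i<l. (real n - real i) / real n)"
      using elim by (intro prod.cong) (auto simp: field_simps)
    then show ?case by (simp add: falling_def prod_dividef)
  qed
qed

text \<open>The full-grid sum factors over blocks. Tuples with a repetition weigh at most
  \<open>K ^ ?L\<close> each, and their share of the grid tends to 0 by
  \<open>falling_div_power_limit\<close>.\<close>

lemma distinct_blocks_limit:
  assumes "in_C \<rho>" "0 \<notin> set as"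
  shows "(\<lambda>n. (\<Sum>p\<in>S_tuples n (sum_list as). pair_weight \<rho> n p (rotate_blocks as p)) / real n ^ sum_list as)
    \<longlonglongrightarrow> (\<Prod>a\<leftarrow>as. real a * c_rho \<rho> a)"
proof -
  let ?L = "sum_list as" and ?w = "\<lambda>n p. pair_weight \<rho> n p (rotate_blocks as p)"
  obtain \<delta> K where "\<delta> > 0" and b: "\<And>x y. x \<in> {0..1} \<Longrightarrow> y \<in> {0..1} \<Longrightarrow> \<delta> \<le> \<rho> x y \<and> \<rho> x y \<le> K"
    using in_C_bounds[OF assms(1)] by blast
  have w: "0 < ?w n p" "?w n p \<le> K ^ ?L" if "p \<in> lists_upto n ?L" for n p
    using pair_weight_bounds[OF b \<open>\<delta> > 0\<close> that rotate_blocks_lists_upto[OF that]] by auto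
  have all: "(\<lambda>n. (\<Sum>p\<in>lists_upto n ?L. ?w n p) / real n ^ ?L) \<longlonglongrightarrow> (\<Prod>a\<leftarrow>as. real a * c_rho \<rho> a)"
    unfolding sum_pair_weight_blocks using assms(2)
  proof (induction as)
    case (Cons a as)
    have "(\<lambda>n. (\<Sum>x\<in>lists_upto n a. pair_weight \<rho> n x (rotate1 x)) / real n ^ a *
        ((\<Prod>a\<leftarrow>as. \<Sum>x\<in>lists_upto n a. pair_weight \<rho> n x (rotate1 x)) / real n ^ sum_list as))
      \<longlonglongrightarrow> real a * c_rho \<rho> a * (\<Prod>a\<leftarrow>as. real a * c_rho \<rho> a)"
      using Cons by (intro tendsto_mult cycle_weight_limit[OF assms(1)]) auto
    then show ?case by (simp add: power_add)
  qed simp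
  have sub: "S_tuples n l \<subseteq> lists_upto n l" for n l by (auto simp: S_tuples_def lists_upto_def)
  have rest: "(\<lambda>n. (\<Sum>p\<in>lists_upto n ?L - S_tuples n ?L. ?w n p) / real n ^ ?L) \<longlonglongrightarrow> 0"
  proof (rule tendsto_sandwich[OF _ _ tendsto_const])
    show "(\<lambda>n. K ^ ?L * (1 - falling n ?L / real n ^ ?L)) \<longlonglongrightarrow> 0"
      using tendsto_mult_left[OF tendsto_diff[OF tendsto_const falling_div_power_limit[of ?L], of 1], of "K ^ ?L"] by simp
    show "\<forall>\<^sub>F n in sequentially. 0 \<le> (\<Sum>p\<in>lists_upto n ?L - S_tuples n ?L. ?w n p) / real n ^ ?L"
      using w(1) by (intro always_eventually allI divide_nonneg_nonneg sum_nonneg) (auto intro: less_imp_le)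
    show "\<forall>\<^sub>F n in sequentially. (\<Sum>p\<in>lists_upto n ?L - S_tuples n ?L. ?w n p) / real n ^ ?L
        \<le> K ^ ?L * (1 - falling n ?L / real n ^ ?L)"
      using eventually_gt_at_top[of 0]
    proof eventually_elim
      case (elim n)
      have "(\<Sum>p\<in>lists_upto n ?L - S_tuples n ?L. ?w n p) \<le> (\<Sum>p\<in>lists_upto n ?L - S_tuples n ?L. K ^ ?L)"
        using w(2) by (intro sum_mono) auto
      also have "\<dots> = K ^ ?L * (real n ^ ?L - falling n ?L)"
      proof -
        have "card (S_tuples n ?L) \<le> card (lists_upto n ?L)" by (rule card_mono) (use sub in auto)
        then show ?thesis
          by (simp add: card_Diff_subset[OF _ sub] of_nat_diff card_lists_upto card_S_tuples)
      qed
      finally have "(\<Sum>p\<in>lists_upto n ?L - S_tuples n ?L. ?w n p) / real n ^ ?L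
          \<le> K ^ ?L * (real n ^ ?L - falling n ?L) / real n ^ ?L"
        by (rule divide_right_mono) simp
      then show ?case using elim by (simp add: diff_divide_distrib right_diff_distrib)
    qed
  qed
  have "(\<Sum>p\<in>S_tuples n ?L. ?w n p) / real n ^ ?L =
      (\<Sum>p\<in>lists_upto n ?L. ?w n p) / real n ^ ?L - (\<Sum>p\<in>lists_upto n ?L - S_tuples n ?L. ?w n p) / real n ^ ?L" for n
    using sum.subset_diff[OF sub finite_lists_upto, of "?w n" n ?L] by (simp add: add_divide_distrib)
  then show ?thesis using tendsto_diff[OF all rest] by simp
qed

lemma prod_list_eq_prod_count:
  fixes f :: "'a \<Rightarrow> 'b::comm_monoid_mult"
  assumes "finite A" "set xs \<subseteq> A"
  shows "(\<Prod>x\<leftarrow>xs. f x) = (\<Prod>x\<in>A. f x ^ count_list xs x)"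
  using assms(2)
proof (induction xs)
  case (Cons y ys)
  have "(\<Prod>x\<in>A. f x ^ count_list (y # ys) x) = (\<Prod>x\<in>A. (if x = y then f x else 1) * f x ^ count_list ys x)"
    by (rule prod.cong) auto
  also have "\<dots> = f y * (\<Prod>x\<in>A. f x ^ count_list ys x)"
    using assms(1) Cons.prems by (simp add: prod.distrib prod.delta)
  finally show ?case using Cons by simp
qed simp

text \<open>Encodes a family of orders \<open>r\<close> as a list of block lengths, the form in
  which \<open>card_block_cycles\<close> takes them.\<close>

lemma ex_list_count:
  assumes "finite A"
  shows "\<exists>xs. set xs \<subseteq> A \<and> (\<forall>a\<in>A. count_list xs a = r a)"
proof -
  obtain xs where xs: "mset xs = (\<Sum>a\<in>A. replicate_mset (r a) a)"
    using ex_mset by blast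
  have "count_list xs b = (if b \<in> A then r b else 0)" for b
    using assms by (simp flip: count_mset add: xs count_sum sum.delta)
  moreover from this have "b \<in> A" if "b \<in> set xs" for b
    using that count_list_0_iff[of xs b] by (auto split: if_splits)
  ultimately show ?thesis by (intro exI[of _ xs]) auto
qed

lemma expectation_card_block_cycles:
  "measure_pmf.expectation M (\<lambda>\<sigma>. real (card (block_cycles \<sigma> n as))) =
   (\<Sum>p\<in>S_tuples n (sum_list as). measure_pmf.prob M {\<sigma>. map \<sigma> p = rotate_blocks as p})"
proof -
  have "real (card (block_cycles \<sigma> n as)) =
      (\<Sum>p\<in>S_tuples n (sum_list as). indicator {\<sigma>. map \<sigma> p = rotate_blocks as p} \<sigma>)" for \<sigma>
    by (simp add: block_cycles_def indicator_def sum_of_bool_eq Int_def)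
  moreover have "integrable (measure_pmf M) (indicat_real S)" for S
    by (rule integrable_real_indicator) (auto simp: less_top[symmetric])
  ultimately show ?thesis by (simp add: Bochner_Integration.integral_sum)
qed

text \<open>Each probability differs from its weight by at most \<open>\<epsilon>\<close> times that
  weight, so the total error is at most \<open>\<epsilon> * ?t n\<close>, with \<open>?t\<close>
  convergent.\<close>

lemma block_cycles_limit:
  fixes P :: "nat \<Rightarrow> (nat \<Rightarrow> nat) pmf"
  assumes rho: "in_C \<rho>"
    and approx: "\<And>l. l \<ge> 1 \<Longrightarrow> \<forall>\<epsilon>>0. \<forall>\<^sub>F n in sequentially.
        \<forall>p\<in>S_tuples n l. \<forall>q\<in>S_tuples n l.
          \<bar>real n ^ l * measure_pmf.prob (P n) {\<sigma>. map \<sigma> p = q}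
             / (\<Prod>a<l. \<rho> (real (p ! a) / real n) (real (q ! a) / real n)) - 1\<bar> \<le> \<epsilon>"
    and as: "0 \<notin> set as"
  shows "(\<lambda>n. measure_pmf.expectation (P n) (\<lambda>\<sigma>. real (card (block_cycles \<sigma> n as))))
    \<longlonglongrightarrow> (\<Prod>a\<leftarrow>as. real a * c_rho \<rho> a)"
\<comment> \<open>The hypothesis on the law starts at \<open>l = 1\<close>; for no blocks the empty
  tuple is counted once.\<close>
proof (cases "as = []")
  case True
  have "block_cycles \<sigma> n [] = {[]}" for \<sigma> n by (auto simp: block_cycles_def S_tuples_def)
  then show ?thesis using True by simp
next
  case False
  let ?L = "sum_list as" and ?T = "\<Prod>a\<leftarrow>as. real a * c_rho \<rho> a"
  let ?w = "\<lambda>n p. pair_weight \<rho> n p (rotate_blocks as p)"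
  let ?q = "\<lambda>n p. measure_pmf.prob (P n) {\<sigma>. map \<sigma> p = rotate_blocks as p}"
  let ?t = "\<lambda>n. (\<Sum>p\<in>S_tuples n ?L. ?w n p) / real n ^ ?L"
  let ?e = "\<lambda>n. \<Sum>p\<in>S_tuples n ?L. ?q n p"
  have L: "?L \<ge> 1" using False as by (cases as) auto
  obtain \<delta> K where \<delta>: "\<delta> > 0" and b: "\<And>x y. x \<in> {0..1} \<Longrightarrow> y \<in> {0..1} \<Longrightarrow> \<delta> \<le> \<rho> x y \<and> \<rho> x y \<le> K"
    using in_C_bounds[OF rho] by blast
  have w: "?w n p > 0" if "p \<in> S_tuples n ?L" for n p
  proof -
    have p: "p \<in> lists_upto n ?L" using that by (auto simp: S_tuples_def lists_upto_def)
    show ?thesis by (rule pair_weight_bounds(1)[OF b \<delta> p rotate_blocks_lists_upto[OF p]])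
  qed
  have t: "?t \<longlonglongrightarrow> ?T" by (rule distinct_blocks_limit[OF rho as])
  have t0: "?t n \<ge> 0" for n using w by (intro divide_nonneg_nonneg sum_nonneg) (auto intro: less_imp_le)
  have T0: "?T \<ge> 0" by (rule LIMSEQ_le_const[OF t]) (use t0 in blast)
  have "(\<lambda>n. ?e n - ?t n) \<longlonglongrightarrow> 0"
  proof (rule tendstoI)
    fix r :: real assume "r > 0"
    \<comment> \<open>\<open>?T + 1\<close> eventually bounds \<open>?t n\<close>; the factor 2
      leaves room for the strict inequality.\<close>
    define \<epsilon> where "\<epsilon> = r / (2 * (?T + 1))"
    have \<epsilon>: "\<epsilon> > 0" "\<epsilon> * (?T + 1) = r / 2" using \<open>r > 0\<close> T0 by (auto simp: \<epsilon>_def field_simps)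
    have "\<forall>\<^sub>F n in sequentially. ?t n < ?T + 1" by (rule order_tendstoD(2)[OF t]) simp
    moreover have "\<forall>\<^sub>F n in sequentially. \<forall>p\<in>S_tuples n ?L. \<forall>q\<in>S_tuples n ?L.
          \<bar>real n ^ ?L * measure_pmf.prob (P n) {\<sigma>. map \<sigma> p = q}
             / (\<Prod>a<?L. \<rho> (real (p ! a) / real n) (real (q ! a) / real n)) - 1\<bar> \<le> \<epsilon>"
      using approx[OF L] \<epsilon>(1) by blast
    ultimately show "\<forall>\<^sub>F n in sequentially. dist (?e n - ?t n) 0 < r"
      using eventually_gt_at_top[of 0]
    proof eventually_elim
      case (elim n)
      have "\<bar>?q n p - ?w n p / real n ^ ?L\<bar> \<le> \<epsilon> * (?w n p / real n ^ ?L)" if p: "p \<in> S_tuples n ?L" for p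
      proof -
        have len: "length p = ?L" using p by (simp add: S_tuples_def)
        have "\<bar>real n ^ ?L * ?q n p / ?w n p - 1\<bar> \<le> \<epsilon>"
          unfolding pair_weight_def len using elim(2) p rotate_blocks_S_tuples[OF p] by blast
        moreover have pos: "?w n p / real n ^ ?L > 0" using w[OF p] elim(3) by simp
        moreover have "?q n p - ?w n p / real n ^ ?L =
            (real n ^ ?L * ?q n p / ?w n p - 1) * (?w n p / real n ^ ?L)"
          using w[OF p] elim(3) by (simp add: field_simps)
        ultimately show ?thesis by (simp only: abs_mult abs_of_pos mult_right_mono less_imp_le)
      qed
      then have "(\<Sum>p\<in>S_tuples n ?L. \<bar>?q n p - ?w n p / real n ^ ?L\<bar>) \<le>
          (\<Sum>p\<in>S_tuples n ?L. \<epsilon> * (?w n p / real n ^ ?L))"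
        by (rule sum_mono)
      moreover have "?e n - ?t n = (\<Sum>p\<in>S_tuples n ?L. ?q n p - ?w n p / real n ^ ?L)"
        by (simp add: sum_subtractf sum_divide_distrib)
      moreover have "\<bar>\<Sum>p\<in>S_tuples n ?L. ?q n p - ?w n p / real n ^ ?L\<bar> \<le>
          (\<Sum>p\<in>S_tuples n ?L. \<bar>?q n p - ?w n p / real n ^ ?L\<bar>)"
        by (rule sum_abs)
      moreover have "(\<Sum>p\<in>S_tuples n ?L. \<epsilon> * (?w n p / real n ^ ?L)) = \<epsilon> * ?t n"
        by (simp add: sum_divide_distrib sum_distrib_left)
      moreover have "\<epsilon> * ?t n \<le> \<epsilon> * (?T + 1)"
        using elim(1) \<epsilon>(1) by (intro mult_left_mono) auto
      ultimately have "\<bar>?e n - ?t n\<bar> \<le> r / 2" using \<epsilon>(2) by linarith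
      then show ?case using \<open>r > 0\<close> by (simp add: dist_real_def)
    qed
  qed
  from tendsto_add[OF this t] show ?thesis by (simp add: expectation_card_block_cycles)
qed

theorem theorem1p4:
  fixes \<rho> :: "real \<Rightarrow> real \<Rightarrow> real"
    and P :: "nat \<Rightarrow> (nat \<Rightarrow> nat) pmf"
  assumes rho: "in_C \<rho>"
    and perm: "\<And>n. n \<ge> 1 \<Longrightarrow> set_pmf (P n) \<subseteq> {\<sigma>. \<sigma> permutes {1..n}}"
    and approx: "\<And>l. l \<ge> 1 \<Longrightarrow> \<forall>\<epsilon>>0. \<forall>\<^sub>F n in sequentially.
        \<forall>p\<in>S_tuples n l. \<forall>q\<in>S_tuples n l.
          \<bar>real n ^ l * measure_pmf.prob (P n) {\<sigma>. map \<sigma> p = q}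
             / (\<Prod>a<l. \<rho> (real (p ! a) / real n) (real (q ! a) / real n)) - 1\<bar> \<le> \<epsilon>"
  shows "(\<forall>l::nat. \<forall>k::nat \<Rightarrow> nat.
           (\<lambda>n. measure_pmf.expectation (P n)
                   (\<lambda>\<sigma>. \<Prod>a\<in>{1..l}. real (cycle_count \<sigma> n a) ^ k a))
           \<longlonglongrightarrow> (\<Prod>a\<in>{1..l}. measure_pmf.expectation (poisson_pmf (c_rho \<rho> a))
                                      (\<lambda>j. real j ^ k a))) \<and>
         (\<forall>l::nat. \<forall>m::nat \<Rightarrow> nat.
           (\<lambda>n. measure_pmf.prob (P n) {\<sigma>. \<forall>a\<in>{1..l}. cycle_count \<sigma> n a = m a})
           \<longlonglongrightarrow> (\<Prod>a\<in>{1..l}. pmf (poisson_pmf (c_rho \<rho> a)) (m a)))"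
proof -
  \<comment> \<open>\<open>P 0\<close> is unconstrained, so finiteness is available only from
    \<open>n = 1\<close> on.\<close>
  have fin: "\<forall>\<^sub>F n in sequentially. finite (set_pmf (P n))"
    using eventually_ge_at_top[of 1]
  proof eventually_elim
    case (elim n)
    then show ?case using finite_subset[OF perm finite_permutations] by simp
  qed
  have c: "c_rho \<rho> a > 0" if "a \<in> {1..l}" for a l using c_rho_pos[OF rho] that by simp
  have moments: "(\<lambda>n. measure_pmf.expectation (P n) (\<lambda>\<sigma>. \<Prod>a\<in>{1..l}. falling (cycle_count \<sigma> n a) (r a)))
      \<longlonglongrightarrow> (\<Prod>a\<in>{1..l}. c_rho \<rho> a ^ r a)" for l r
  proof -
    obtain as where as: "set as \<subseteq> {1..l}" "\<And>a. a \<in> {1..l} \<Longrightarrow> count_list as a = r a"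
      using ex_list_count[of "{1..l}" r] by blast
    \<comment> \<open>The number of ways to choose starting points; it occurs both in the count and
      in its limit, and cancels.\<close>
    let ?D = "\<Prod>a\<in>{1..l}. real a ^ r a"
    have D: "?D > 0" by (intro prod_pos) auto
    have 0: "0 \<notin> set as" using as(1) by auto
    have T: "(\<Prod>a\<leftarrow>as. real a * c_rho \<rho> a) = ?D * (\<Prod>a\<in>{1..l}. c_rho \<rho> a ^ r a)"
      using as by (simp add: prod_list_eq_prod_count[OF finite_atLeastAtMost as(1)]
          power_mult_distrib flip: prod.distrib)
    have "(\<lambda>n. measure_pmf.expectation (P n) (\<lambda>\<sigma>. real (card (block_cycles \<sigma> n as))) / ?D)
        \<longlonglongrightarrow> (\<Prod>a\<leftarrow>as. real a * c_rho \<rho> a) / ?D"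
      using D by (intro tendsto_divide block_cycles_limit[OF rho approx 0] tendsto_const) auto
    then have "(\<lambda>n. measure_pmf.expectation (P n) (\<lambda>\<sigma>. real (card (block_cycles \<sigma> n as))) / ?D)
        \<longlonglongrightarrow> (\<Prod>a\<in>{1..l}. c_rho \<rho> a ^ r a)"
      using D unfolding T by simp
    then show ?thesis
    proof (rule Lim_transform_eventually)
      show "\<forall>\<^sub>F n in sequentially.
          measure_pmf.expectation (P n) (\<lambda>\<sigma>. real (card (block_cycles \<sigma> n as))) / ?D =
          measure_pmf.expectation (P n) (\<lambda>\<sigma>. \<Prod>a\<in>{1..l}. falling (cycle_count \<sigma> n a) (r a))"
        using eventually_ge_at_top[of 1]
      proof eventually_elim
        case (elim n)
        have "measure_pmf.expectation (P n) (\<lambda>\<sigma>. real (card (block_cycles \<sigma> n as))) =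
            measure_pmf.expectation (P n) (\<lambda>\<sigma>. ?D * (\<Prod>a\<in>{1..l}. falling (cycle_count \<sigma> n a) (r a)))"
        \<comment> \<open>The counting identity is available only for permutations, hence on the
          support of \<open>P n\<close>.\<close>
        proof (rule Bochner_Integration.integral_cong_AE)
          show "AE \<sigma> in measure_pmf (P n). real (card (block_cycles \<sigma> n as)) =
              ?D * (\<Prod>a\<in>{1..l}. falling (cycle_count \<sigma> n a) (r a))"
          proof (rule AE_pmfI)
            fix \<sigma> assume "\<sigma> \<in> set_pmf (P n)"
            then have \<sigma>: "\<sigma> permutes {1..n}" using perm[OF elim] by blast
            show "real (card (block_cycles \<sigma> n as)) = ?D * (\<Prod>a\<in>{1..l}. falling (cycle_count \<sigma> n a) (r a))"
              using as(2) by (simp add: card_block_cycles[OF \<sigma> _ finite_atLeastAtMost as(1)] flip: prod.distrib)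
          qed
        qed auto
        then show ?case using D by simp
      qed
    qed
  qed
  have "(\<lambda>n. measure_pmf.expectation (P n) (\<lambda>\<sigma>. \<Prod>a\<in>{1..l}. real (cycle_count \<sigma> n a) ^ k a))
      \<longlonglongrightarrow> (\<Prod>a\<in>{1..l}. measure_pmf.expectation (poisson_pmf (c_rho \<rho> a)) (\<lambda>j. real j ^ k a))" for l k
    by (rule joint_limit_by_coordinates[where X = "\<lambda>n a \<sigma>. cycle_count \<sigma> n a" and g = "\<lambda>a x. real x ^ k a",
          OF finite_atLeastAtMost _ moments weighted_power_limit[OF c fin]]) auto
  moreover have "(\<lambda>n. measure_pmf.prob (P n) {\<sigma>. \<forall>a\<in>{1..l}. cycle_count \<sigma> n a = m a})
      \<longlonglongrightarrow> (\<Prod>a\<in>{1..l}. pmf (poisson_pmf (c_rho \<rho> a)) (m a))" for l m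
  proof -
    have "(\<lambda>n. measure_pmf.expectation (P n) (\<lambda>\<sigma>. \<Prod>a\<in>{1..l}. of_bool (cycle_count \<sigma> n a = m a)))
      \<longlonglongrightarrow> (\<Prod>a\<in>{1..l}. pmf (poisson_pmf (c_rho \<rho> a)) (m a))"
      by (rule joint_limit_by_coordinates[where X = "\<lambda>n a \<sigma>. cycle_count \<sigma> n a" and g = "\<lambda>a x. of_bool (x = m a)",
            OF finite_atLeastAtMost _ moments weighted_point_limit[OF c fin]]) auto
    moreover have "(\<Prod>a\<in>{1..l}. of_bool (cycle_count \<sigma> n a = m a)) =
        (indicator {\<sigma>. \<forall>a\<in>{1..l}. cycle_count \<sigma> n a = m a} \<sigma> :: real)" for n \<sigma>
      by (cases "\<forall>a\<in>{1..l}. cycle_count \<sigma> n a = m a") (auto intro!: prod.neutral prod_zero)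
    ultimately show ?thesis by simp
  qed
  ultimately show ?thesis by blast
qed

end
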